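(* Let $U,V$ be copulas. Then: (1) If $\|U\|=1$ and $\|V\|=1$, then $\|U*V\|=1$. (2) If $\|U*V\|=1$, then $\|U\|=1$ if and only if $\|V\|=1$.
   Context: A (bivariate) copula is a function $C\colon[0,1]^2\to[0,1]$ with $C(u,0)=0=C(0,v)$, $C(u,1)=u$, $C(1,v)=v$ and $C(u,v)-C(u,y)-C(x,v)+C(x,y)\ge 0$ whenever $x\le u$, $y\le v$. The Sobolev norm is $\|C\|^2=\int_0^1\int_0^1\big((\partial_1C(x,y))^2+(\partial_2C(x,y))^2\big)\,dx\,dy$. The $*$-product of copulas is $(C*D)(x,y)=\int_0^1\partial_2C(x,t)\,\partial_1D(t,y)\,dt$, which is again a copula. *)

theory Defs
  imports "HOL-Analysis.Analysis"
begin

text \<open>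
  A function on the unit square is represented by a total function on pairs of reals, of which
  only the values on the square matter.
\<close>

definition copula :: "(real \<Rightarrow> real \<Rightarrow> real) \<Rightarrow> bool" where
  "copula C \<longleftrightarrow>
     (\<forall>u\<in>{0..1}. \<forall>v\<in>{0..1}. C u v \<in> {0..1}) \<and>
     (\<forall>u\<in>{0..1}. C u 0 = 0 \<and> C u 1 = u) \<and>
     (\<forall>v\<in>{0..1}. C 0 v = 0 \<and> C 1 v = v) \<and>
     (\<forall>x\<in>{0..1}. \<forall>u\<in>{0..1}. \<forall>y\<in>{0..1}. \<forall>v\<in>{0..1}.
        x \<le> u \<longrightarrow> y \<le> v \<longrightarrow> C u v - C u y - C x v + C x y \<ge> 0)"

text \<open>
  The partial derivatives of a copula exist almost everywhere. Where they do not exist,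
  \<^const>\<open>deriv\<close> is an unspecified constant, and at the boundary of the square it may depend
  on values outside of it; both happen on null sets only and do not affect the integrals below.
\<close>

definition partial1 :: "(real \<Rightarrow> real \<Rightarrow> real) \<Rightarrow> real \<Rightarrow> real \<Rightarrow> real" where
  "partial1 C x y = deriv (\<lambda>s. C s y) x"

definition partial2 :: "(real \<Rightarrow> real \<Rightarrow> real) \<Rightarrow> real \<Rightarrow> real \<Rightarrow> real" where
  "partial2 C x y = deriv (\<lambda>t. C x t) y"

definition sobolev_norm :: "(real \<Rightarrow> real \<Rightarrow> real) \<Rightarrow> real" where
  "sobolev_norm C =
     sqrt (LBINT y:{0..1}. LBINT x:{0..1}. (partial1 C x y)\<^sup>2 + (partial2 C x y)\<^sup>2)"

definition copula_prod ::
  "(real \<Rightarrow> real \<Rightarrow> real) \<Rightarrow> (real \<Rightarrow> real \<Rightarrow> real) \<Rightarrow> real \<Rightarrow> real \<Rightarrow> real" where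
  "copula_prod C D x y = (LBINT t:{0..1}. partial2 C x t * partial1 D t y)"

end

theory Submission
  imports Defs "HOL-Probability.Probability_Measure"
begin

text \<open>
  The proof is probabilistic. A copula \<open>C\<close> is the joint distribution function of two random
  variables \<open>X\<close>, \<open>Y\<close> that are uniform on the unit interval, and \<open>\<partial>\<^sub>1C(x, y)\<close> is the conditional
  probability of \<open>Y < y\<close> given \<open>X = x\<close>. As both partial derivatives lie in \<open>[0, 1]\<close> and have integral
  \<open>1/2\<close> over the square, the integral of the sum of their squares is at most \<open>1\<close>, and it equals \<open>1\<close>
  exactly if both derivatives take almost only the values \<open>0\<close> and \<open>1\<close>
  (\<open>sobolev_norm_eq_1_iff\<close>). For \<open>\<partial>\<^sub>1C\<close> this says that \<open>X\<close> decides every event \<open>Y < y\<close> up to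
  a null set, that is, that \<open>X\<close> determines \<open>Y\<close> almost surely. Hence \<open>C\<close> has norm \<open>1\<close> if and
  only if each of \<open>X\<close> and \<open>Y\<close> determines the other
  (\<open>sobolev_norm_eq_1_iff_determines\<close>).

  The product \<open>U * V\<close> is the distribution of \<open>(X, Y)\<close> if \<open>(X, T)\<close> has distribution \<open>U\<close>, \<open>(T, Y)\<close> has
  distribution \<open>V\<close>, and \<open>X\<close> and \<open>Y\<close> are conditionally independent given \<open>T\<close>. Such a triple
  exists (\<open>copula_prod_coupling\<close>). On its probability space the three norms express mutual
  determination within the pairs \<open>X, T\<close> and \<open>T, Y\<close> and \<open>X, Y\<close>. Mutual determination is
  symmetric and transitive, so any two of the three conditions imply the third, which is what both
  parts of the theorem say.

  The analytic input is that a copula is monotone and 1-Lipschitz in each variable, so that its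
  sections are differentiable almost everywhere and are the integrals of their derivatives
  (\<open>Lipschitz_mono_fundamental_theorem\<close>).
\<close>

section \<open>Monotone Lipschitz functions on the line\<close>

lemma Lipschitz_mono_continuous:
  fixes F :: "real \<Rightarrow> real"
  assumes mono: "\<And>x y. x \<le> y \<Longrightarrow> F x \<le> F y"
    and lip: "\<And>x y. x \<le> y \<Longrightarrow> F y - F x \<le> y - x"
  shows "continuous_on UNIV F"
proof (rule continuous_onI)
  fix x e :: real assume "e > 0"
  have "dist (F y) (F x) \<le> dist y x" for y
    using mono[of x y] mono[of y x] lip[of x y] lip[of y x] by (cases "x \<le> y") (auto simp: dist_real_def)
  then show "\<exists>d>0. \<forall>y\<in>UNIV. dist y x < d \<longrightarrow> dist (F y) (F x) \<le> e"
    using \<open>e > 0\<close> by (meson less_eq_real_def order_trans)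
qed

text \<open>
  The function \<open>G x = x - F x\<close> is monotone as well, and the Stieltjes measures of \<open>F\<close> and \<open>G\<close> add up
  to Lebesgue measure. So the measure of \<open>F\<close> is dominated by Lebesgue measure.
\<close>

lemma interval_measure_absolutely_continuous:
  fixes F :: "real \<Rightarrow> real"
  assumes mono: "\<And>x y. x \<le> y \<Longrightarrow> F x \<le> F y"
    and lip: "\<And>x y. x \<le> y \<Longrightarrow> F y - F x \<le> y - x"
  shows "absolutely_continuous lborel (interval_measure F)"
proof -
  define G where "G = (\<lambda>x. x - F x)"
  have cont: "continuous_on UNIV F"
    using mono lip by (rule Lipschitz_mono_continuous)
  have contG: "continuous_on UNIV G"
    unfolding G_def by (intro continuous_intros cont)
  have monoG: "\<And>x y. x \<le> y \<Longrightarrow> G x \<le> G y"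
    unfolding G_def using lip by (simp add: algebra_simps)
  define N where "N = (\<lambda>A. emeasure (interval_measure F) A + emeasure (interval_measure G) A)"
  define M where "M = measure_of UNIV (sets borel) N"
  have sM[simp]: "sets M = sets borel"
    unfolding M_def by (metis sets.sets_measure_of_eq space_borel)
  have eM: "emeasure M A = N A" if "A \<in> sets borel" for A
  proof (rule emeasure_measure_of[OF M_def])
    show "sets borel \<subseteq> Pow (UNIV::real set)" by auto
    show "A \<in> sets M" using that by simp
    show "positive (sets M) N" by (simp add: positive_def N_def)
    show "countably_additive (sets M) N"
      unfolding countably_additive_def N_def
    proof safe
      fix A :: "nat \<Rightarrow> real set" assume "range A \<subseteq> sets M" and d: "disjoint_family A"
      then have r: "range A \<subseteq> sets (interval_measure F)" "range A \<subseteq> sets (interval_measure G)" by auto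
      show "(\<Sum>i. emeasure (interval_measure F) (A i) + emeasure (interval_measure G) (A i)) =
         emeasure (interval_measure F) (\<Union> (range A)) + emeasure (interval_measure G) (\<Union> (range A))"
        by (simp add: suminf_add[symmetric] suminf_emeasure[OF r(1) d] suminf_emeasure[OF r(2) d])
    qed
  qed
  have box: "emeasure (interval_measure H) {l<..<u} = ennreal (H u - H l)"
    if "l \<le> u" and H: "\<And>x y. x \<le> y \<Longrightarrow> H x \<le> H y" "continuous_on UNIV H" for l u H
  proof -
    have "emeasure (interval_measure H) {u} = 0"
      using emeasure_interval_measure_Icc[of u u H] H by simp
    moreover have "emeasure (interval_measure H) {l<..u} = ennreal (H u - H l)"
      using that by (intro emeasure_interval_measure_Ioc)
        (auto intro: continuous_on_subset simp: continuous_on_eq_continuous_at continuous_at_imp_continuous_at_within)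
    moreover have "{l<..<u} = {l<..u} - {u}" by auto
    ultimately show ?thesis
      by (metis (no_types, lifting) emeasure_Diff_null_set null_setsI sets_interval_measure
          borel_closed borel_singleton sets.empty_sets greaterThanAtMost_borel)
  qed
  have "lborel = M"
  proof (rule lborel_eqI)
    fix l u :: real assume *: "\<And>b. b \<in> Basis \<Longrightarrow> l \<bullet> b \<le> u \<bullet> b"
    then have lu: "l \<le> u" by simp
    have "emeasure M (box l u) = N {l<..<u}" by (simp add: eM box_real)
    also have "\<dots> = ennreal (F u - F l) + ennreal (G u - G l)"
      unfolding N_def using box[OF lu mono cont] box[OF lu monoG contG] by simp
    also have "\<dots> = ennreal (u - l)"
      using mono[OF lu] monoG[OF lu] by (subst ennreal_plus[symmetric]) (auto simp: G_def)
    finally show "emeasure M (box l u) = (\<Prod>b\<in>Basis. (u - l) \<bullet> b)" by simp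
  qed simp
  then have "null_sets lborel \<subseteq> null_sets (interval_measure F)"
    using eM by (auto simp: null_sets_def N_def)
  then show ?thesis by (simp add: absolutely_continuous_def)
qed

lemma Lipschitz_mono_has_density:
  fixes F :: "real \<Rightarrow> real"
  assumes mono: "\<And>x y. x \<le> y \<Longrightarrow> F x \<le> F y"
    and lip: "\<And>x y. x \<le> y \<Longrightarrow> F y - F x \<le> y - x"
  obtains g where "g \<in> borel_measurable borel" "\<And>x. 0 \<le> g x"
    "\<And>a b. a \<le> b \<Longrightarrow> (\<integral>\<^sup>+x\<in>{a..b}. ennreal (g x) \<partial>lborel) = ennreal (F b - F a)"
proof -
  have cont: "continuous_on UNIV F"
    using mono lip by (rule Lipschitz_mono_continuous)
  obtain f where f[measurable]: "f \<in> borel_measurable lborel" and df: "density lborel f = interval_measure F"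
    using sigma_finite_measure.Radon_Nikodym[OF sigma_finite_lborel
        interval_measure_absolutely_continuous[OF mono lip]] by auto
  have I: "(\<integral>\<^sup>+x\<in>{a..b}. f x \<partial>lborel) = ennreal (F b - F a)" if "a \<le> b" for a b
  proof -
    have "emeasure (density lborel f) {a..b} = ennreal (F b - F a)"
      unfolding df using that mono cont by (rule emeasure_interval_measure_Icc)
    then show ?thesis by (subst (asm) emeasure_density) auto
  qed
  have "AE x in lborel. \<forall>n::nat. f x * indicator {- real n..real n} x \<noteq> \<infinity>"
    unfolding AE_all_countable by (intro allI nn_integral_PInf_AE) (auto simp: I)
  then have fin: "AE x in lborel. f x \<noteq> \<infinity>"
  proof eventually_elim
    case (elim x)
    obtain n :: nat where "\<bar>x\<bar> \<le> real n" using real_arch_simple by blast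
    with elim[rule_format, of n] show ?case by (auto simp: indicator_def abs_le_iff)
  qed
  show ?thesis
  proof
    show "(\<lambda>x. enn2real (f x)) \<in> borel_measurable borel" using f by simp
    fix a b :: real assume "a \<le> b"
    have "(\<integral>\<^sup>+x\<in>{a..b}. ennreal (enn2real (f x)) \<partial>lborel) = (\<integral>\<^sup>+x\<in>{a..b}. f x \<partial>lborel)"
      by (rule nn_integral_cong_AE) (use fin in \<open>eventually_elim; simp add: less_top\<close>)
    then show "(\<integral>\<^sup>+x\<in>{a..b}. ennreal (enn2real (f x)) \<partial>lborel) = ennreal (F b - F a)"
      using I[OF \<open>a \<le> b\<close>] by simp
  qed simp
qed

text \<open>
  One half of Lebesgue's differentiation theorem: the averages are taken over intervals to the
  right of the point. Reflecting the line yields the other half.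
\<close>

lemma AE_right_derivative_of_integral:
  fixes F g :: "real \<Rightarrow> real"
  assumes int: "\<And>a b. a \<le> b \<Longrightarrow> (g has_integral (F b - F a)) {a..b}"
  shows "AE x in lebesgue. ((\<lambda>h. (F (x + h) - F x) / h) \<longlongrightarrow> g x) (at_right 0)"
proof -
  have "g integrable_on cbox a b" for a b
    using int[of a b] by (cases "a \<le> b") (auto simp: integrable_on_def)
  then obtain N where N: "negligible N"
    "\<And>x e. \<lbrakk>x \<notin> N; 0 < e\<rbrakk> \<Longrightarrow> \<exists>d>0. \<forall>h. 0 < h \<and> h < d \<longrightarrow>
         norm (integral (cbox x (x + h *\<^sub>R One)) g /\<^sub>R h ^ DIM(real) - g x) < e"
    using integrable_ccontinuous_explicit by blast
  have "((\<lambda>h. (F (x + h) - F x) / h) \<longlongrightarrow> g x) (at_right 0)" if "x \<notin> N" for x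
  proof (rule tendstoI)
    fix e :: real assume "e > 0"
    with N(2)[OF that] obtain d where "d > 0" and
      d: "\<And>h. 0 < h \<Longrightarrow> h < d \<Longrightarrow> \<bar>integral {x..x + h} g / h - g x\<bar> < e"
      by (force simp: divide_inverse_commute)
    have "integral {x..x + h} g = F (x + h) - F x" if "h > 0" for h
      using int[of x "x + h"] that by (simp add: integral_unique)
    then show "eventually (\<lambda>h. dist ((F (x + h) - F x) / h) (g x) < e) (at_right 0)"
      unfolding eventually_at_right_field dist_real_def using d \<open>d > 0\<close> by (metis)
  qed
  then show ?thesis
    using N(1) by (intro AE_I'[of N]) (auto simp: negligible_iff_null_sets)
qed

text \<open>
  Lebesgue's fundamental theorem of calculus. The Radon--Nikodym density of the Stieltjes measure of
  \<open>F\<close> is its derivative almost everywhere, because one-sided averages of a density converge to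
  it from the right and, by reflection, from the left.
\<close>

lemma Lipschitz_mono_fundamental_theorem:
  fixes F :: "real \<Rightarrow> real"
  assumes mono: "\<And>x y. x \<le> y \<Longrightarrow> F x \<le> F y"
    and lip: "\<And>x y. x \<le> y \<Longrightarrow> F y - F x \<le> y - x"
  shows "AE x in lborel. (F has_real_derivative deriv F x) (at x) \<and> deriv F x \<in> {0..1}"
    and "a \<le> b \<Longrightarrow> (\<integral>\<^sup>+x\<in>{a..b}. ennreal (deriv F x) \<partial>lborel) = ennreal (F b - F a)"
proof -
  obtain g where g[measurable]: "g \<in> borel_measurable borel" and g0: "\<And>x. 0 \<le> g x"
    and I: "\<And>a b. a \<le> b \<Longrightarrow> (\<integral>\<^sup>+x\<in>{a..b}. ennreal (g x) \<partial>lborel) = ennreal (F b - F a)"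
    using Lipschitz_mono_has_density[OF mono lip] by auto
  have hi: "(g has_integral (F b - F a)) {a..b}" if "a \<le> b" for a b
  proof -
    have "((\<lambda>x. g x * indicator {a..b} x) has_integral (F b - F a)) UNIV"
      using g0 I[OF that] mono[OF that]
      by (intro nn_integral_has_integral) (auto simp: nn_integral_set_ennreal)
    moreover have "(\<lambda>x. g x * indicator {a..b} x) = (\<lambda>x. if x \<in> {a..b} then g x else 0)"
      by (auto simp: indicator_def)
    ultimately show ?thesis by (simp only: has_integral_restrict_UNIV)
  qed
  have R: "AE x in lebesgue. ((\<lambda>h. (F (x + h) - F x) / h) \<longlongrightarrow> g x) (at_right 0)"
    by (rule AE_right_derivative_of_integral[OF hi])
  \<comment> \<open>The function \<open>x \<mapsto> - F (- x)\<close> is the integral of \<open>x \<mapsto> g (- x)\<close>, and its right-hand difference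
    quotients at \<open>- x\<close> are the left-hand ones of \<open>F\<close> at \<open>x\<close>.\<close>
  have L: "AE x in lebesgue. ((\<lambda>h. (- F (- (x + h)) - - F (- x)) / h) \<longlongrightarrow> g (- x)) (at_right 0)"
  proof (rule AE_right_derivative_of_integral)
    fix a b :: real assume "a \<le> b"
    then show "((\<lambda>x. g (- x)) has_integral - F (- b) - - F (- a)) {a..b}"
      using hi[of "-b" "-a"] has_integral_reflect_real[of g "F (- a) - F (- b)" "-a" "-b"] by simp
  qed
  have L': "AE x in lborel. ((\<lambda>h. (F (x - h) - F x) / (- h)) \<longlongrightarrow> g x) (at_right 0)"
  proof -
    have "AE x in lborel. ((\<lambda>h. (- F (- (x + h)) - - F (- x)) / h) \<longlongrightarrow> g (- x)) (at_right 0)"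
      using L by (simp add: AE_completion_iff)
    then have "AE x in distr lborel borel uminus. ((\<lambda>h. (- F (- (x + h)) - - F (- x)) / h) \<longlongrightarrow> g (- x)) (at_right 0)"
      by (subst lborel_distr_uminus)
    then have "AE x in lborel. ((\<lambda>h. (- F (- (- x + h)) - - F (- (- x))) / h) \<longlongrightarrow> g (- (- x))) (at_right 0)"
      by (intro AE_distrD[where M = lborel and f = uminus and M' = borel
          and P = "\<lambda>x. ((\<lambda>h. (- F (- (x + h)) - - F (- x)) / h) \<longlongrightarrow> g (- x)) (at_right 0)"]) simp_all
    moreover have "(- F (- (- x + h)) - - F (- (- x))) / h = (F (x - h) - F x) / (- h)" for x h
      by (simp add: diff_divide_distrib)
    ultimately show ?thesis by (simp only: minus_minus)
  qed
  have D: "AE x in lborel. (F has_real_derivative g x) (at x)"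
    using L' R[unfolded AE_completion_iff]
  proof eventually_elim
    case (elim x)
    then show ?case
      unfolding DERIV_def
      by (intro filterlim_split_at) (simp_all add: filterlim_at_left_to_right[of _ _ 0])
  qed
  have bd: "d \<in> {0..1}" if "(F has_real_derivative d) (at x)" for d x
  proof -
    have "((\<lambda>h. (F (x + h) - F x) / h) \<longlongrightarrow> d) (at_right 0)"
      using that unfolding DERIV_def filterlim_at_split by simp
    moreover have "eventually (\<lambda>h. (F (x + h) - F x) / h \<in> {0..1}) (at_right 0)"
      unfolding eventually_at_right_field
    proof (intro exI[of _ 1] conjI allI impI)
      fix h :: real assume "h > 0"
      then show "(F (x + h) - F x) / h \<in> {0..1}"
        using mono[of x "x + h"] lip[of x "x + h"] by simp
    qed simp
    ultimately show ?thesis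
      by (intro Lim_in_closed_set[of "{0..1}"]) auto
  qed
  show "AE x in lborel. (F has_real_derivative deriv F x) (at x) \<and> deriv F x \<in> {0..1}"
    using D
  proof eventually_elim
    case (elim x)
    then show ?case using bd[OF elim] by (simp add: DERIV_imp_deriv)
  qed
  assume "a \<le> b"
  have "(\<integral>\<^sup>+x\<in>{a..b}. ennreal (deriv F x) \<partial>lborel) = (\<integral>\<^sup>+x\<in>{a..b}. ennreal (g x) \<partial>lborel)"
    by (rule nn_integral_cong_AE) (use D in \<open>eventually_elim; simp add: DERIV_imp_deriv\<close>)
  with I[OF \<open>a \<le> b\<close>] show "(\<integral>\<^sup>+x\<in>{a..b}. ennreal (deriv F x) \<partial>lborel) = ennreal (F b - F a)" by simp
qed

text \<open>
  Differentiability can be tested with rational increments since \<open>f\<close> is continuous, and the only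
  candidate for the derivative is the limit \<open>L\<close> of the difference quotients with increments
  \<open>1 / (n + 1)\<close>. This turns the set of points of differentiability into a countable combination of
  Borel conditions, jointly in both variables. Where the derivative does not exist,
  \<^const>\<open>deriv\<close> has a fixed value.
\<close>

lemma borel_measurable_deriv_parametric:
  fixes f :: "real \<Rightarrow> real \<Rightarrow> real"
  assumes cont: "continuous_on UNIV (\<lambda>(s, y). f s y)"
  shows "(\<lambda>p. deriv (\<lambda>s. f s (snd p)) (fst p)) \<in> borel_measurable (borel \<Otimes>\<^sub>M borel)"
proof -
  let ?B = "borel \<Otimes>\<^sub>M borel :: (real \<times> real) measure"
  have fm[measurable (raw)]: "(\<lambda>p. f (u p) (v p)) \<in> borel_measurable ?B"
    if [measurable]: "u \<in> borel_measurable ?B" "v \<in> borel_measurable ?B"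
    for u v :: "real \<times> real \<Rightarrow> real"
    using measurable_compose[OF _ borel_measurable_continuous_onI[OF cont], of "\<lambda>p. (u p, v p)" ?B]
    by simp
  define L where "L = (\<lambda>p. lim (\<lambda>n. (f (fst p + 1 / Suc n) (snd p) - f (fst p) (snd p)) / (1 / Suc n)))"
  have L[measurable]: "L \<in> borel_measurable ?B"
    unfolding L_def by measurable
  define D where "D = {p. \<forall>k::nat. \<exists>n::nat. \<forall>q::rat. \<bar>of_rat q\<bar> < 1 / real (Suc n) \<longrightarrow>
     \<bar>f (fst p + of_rat q) (snd p) - f (fst p) (snd p) - of_rat q * L p\<bar> \<le> \<bar>of_rat q\<bar> / real (Suc k)}"
  have "{p \<in> space ?B. \<forall>k::nat. \<exists>n::nat. \<forall>q::rat. \<bar>of_rat q\<bar> < 1 / real (Suc n) \<longrightarrow>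
     \<bar>f (fst p + of_rat q) (snd p) - f (fst p) (snd p) - of_rat q * L p\<bar> \<le> \<bar>of_rat q\<bar> / real (Suc k)} \<in> sets ?B"
    by measurable
  then have D[measurable]: "D \<in> sets ?B"
    unfolding D_def by (simp add: space_pair_measure)
  have der: "((\<lambda>s. f s y) has_real_derivative L (x, y)) (at x)" if "(x, y) \<in> D" for x y
    unfolding has_field_derivative_def has_derivative_at_alt
  proof (intro conjI allI impI)
    show "bounded_linear ((*) (L (x, y)))" by (rule bounded_linear_mult_right)
    fix e :: real assume "e > 0"
    then obtain k :: nat where k: "1 / Suc k < e" using nat_approx_posE by blast
    from that obtain n where n: "\<And>q::rat. \<bar>of_rat q\<bar> < 1 / real (Suc n) \<Longrightarrow>
       \<bar>f (x + of_rat q) y - f x y - of_rat q * L (x, y)\<bar> \<le> \<bar>of_rat q\<bar> / real (Suc k)"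
      unfolding D_def by fastforce
    have h: "\<bar>f (x + h) y - f x y - h * L (x, y)\<bar> \<le> \<bar>h\<bar> / real (Suc k)" if h: "\<bar>h\<bar> < 1 / real (Suc n)" for h
    proof (rule ccontr)
      let ?S = "{h. \<bar>h\<bar> < 1 / real (Suc n) \<and> \<bar>h\<bar> / real (Suc k) < \<bar>f (x + h) y - f x y - h * L (x, y)\<bar>}"
      assume "\<not> ?thesis"
      with h have "h \<in> ?S" by simp
      have "continuous_on UNIV (\<lambda>h. f (x + h) y)"
        using continuous_on_compose2[OF cont, of UNIV "\<lambda>h. (x + h, y)"]
        by (simp add: continuous_intros)
      then have "open ?S"
        unfolding Collect_conj_eq by (intro open_Int open_Collect_less continuous_intros) auto
      with \<open>h \<in> ?S\<close> have "\<exists>r\<in>\<rat>. r \<in> ?S"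
        using open_Int_closure_eq_empty[of ?S \<rat>] Rats_closure_real by blast
      then show False using n by (fastforce elim!: Rats_cases)
    qed
    show "\<exists>d>0. \<forall>z. norm (z - x) < d \<longrightarrow>
        norm (f z y - f x y - L (x, y) * (z - x)) \<le> e * norm (z - x)"
    proof (intro exI[of _ "1 / real (Suc n)"] conjI allI impI)
      fix z assume z: "norm (z - x) < 1 / real (Suc n)"
      have "norm (f z y - f x y - L (x, y) * (z - x)) \<le> \<bar>z - x\<bar> / real (Suc k)"
        using h[of "z - x"] z by (simp add: mult.commute)
      also have "\<dots> = 1 / Suc k * \<bar>z - x\<bar>" by simp
      also have "\<dots> \<le> e * \<bar>z - x\<bar>" using k by (intro mult_right_mono) auto
      finally show "norm (f z y - f x y - L (x, y) * (z - x)) \<le> e * norm (z - x)" by simp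
    qed simp
  qed
  have inD: "(x, y) \<in> D" if d: "((\<lambda>s. f s y) has_real_derivative d) (at x)" for x y d
  proof -
    have "((\<lambda>h. (f (x + h) y - f x y) / h) \<longlongrightarrow> d) (at 0)"
      using d unfolding DERIV_def .
    then have "(\<lambda>n. (f (x + 1 / Suc n) y - f x y) / (1 / Suc n)) \<longlonglongrightarrow> d"
      by (rule filterlim_compose)
        (intro filterlim_atI LIMSEQ_Suc[OF lim_1_over_n], simp)
    then have L: "L (x, y) = d" unfolding L_def by (simp add: limI)
    show ?thesis
      unfolding D_def
    proof (intro CollectI allI)
      fix k :: nat
      obtain e where "e > 0" and e: "\<And>z. \<bar>z - x\<bar> < e \<Longrightarrow> \<bar>f z y - f x y - d * (z - x)\<bar> \<le> 1 / Suc k * \<bar>z - x\<bar>"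
        using d unfolding has_field_derivative_def has_derivative_at_alt real_norm_def
        by (meson of_nat_0_less_iff zero_less_Suc zero_less_divide_1_iff)
      obtain n :: nat where n: "1 / Suc n < e" using nat_approx_posE \<open>e > 0\<close> by blast
      have "\<bar>f (x + of_rat q) y - f x y - of_rat q * L (x, y)\<bar> \<le> \<bar>of_rat q\<bar> / real (Suc k)"
        if "\<bar>of_rat q\<bar> < 1 / real (Suc n)" for q
        using e[of "x + of_rat q"] that n by (simp add: L mult.commute)
      then show "\<exists>n::nat. \<forall>q::rat. \<bar>of_rat q\<bar> < 1 / real (Suc n) \<longrightarrow>
        \<bar>f (fst (x, y) + of_rat q) (snd (x, y)) - f (fst (x, y)) (snd (x, y)) - of_rat q * L (x, y)\<bar>
          \<le> \<bar>of_rat q\<bar> / real (Suc k)"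
        by auto
    qed
  qed
  have "deriv (\<lambda>s. f s (snd p)) (fst p) = (if p \<in> D then L p else (SOME d. False))" for p
  proof (cases "p \<in> D")
    case True
    then show ?thesis using der[of "fst p" "snd p"] by (simp add: DERIV_imp_deriv)
  next
    case False
    then have "\<not> ((\<lambda>s. f s (snd p)) has_real_derivative d) (at (fst p))" for d
      using inD[of "snd p" d "fst p"] by auto
    then show ?thesis using False by (simp add: deriv_def)
  qed
  then show "(\<lambda>p. deriv (\<lambda>s. f s (snd p)) (fst p)) \<in> borel_measurable ?B"
    by (simp add: measurable_If D)
qed

section \<open>Partial derivatives of a copula and its norm\<close>

definition clamp01 :: "real \<Rightarrow> real" where
  "clamp01 x = max 0 (min 1 x)"

lemma clamp01_bounds [simp]: "0 \<le> clamp01 x" "clamp01 x \<le> 1"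
  by (auto simp: clamp01_def)

lemma clamp01_in [simp]: "clamp01 x \<in> {0..1}"
  by (auto simp: clamp01_def)

lemma clamp01_ident: "x \<in> {0..1} \<Longrightarrow> clamp01 x = x"
  by (auto simp: clamp01_def)

lemma clamp01_mono: "x \<le> y \<Longrightarrow> clamp01 x \<le> clamp01 y"
  by (auto simp: clamp01_def)

lemma clamp01_Lipschitz: "x \<le> y \<Longrightarrow> clamp01 y - clamp01 x \<le> y - x"
  by (auto simp: clamp01_def)

lemma AE_const_imp: "(AE x in M. P \<longrightarrow> Q x) \<longleftrightarrow> (P \<longrightarrow> (AE x in M. Q x))"
  by (cases P) simp_all

text \<open>
  Copulas that are extended to the plane by projecting each coordinate to the unit interval. The
  extension stays monotone and 1-Lipschitz in each variable, so boundary points of the square need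
  no separate treatment.
\<close>

locale extended_copula =
  fixes C :: "real \<Rightarrow> real \<Rightarrow> real"
  assumes copula: "copula C"
    and clamped: "C (clamp01 x) (clamp01 y) = C x y"
begin

lemma transpose: "extended_copula (\<lambda>x y. C y x)"
proof
  show "copula (\<lambda>x y. C y x)"
    unfolding copula_def
  proof (intro conjI ballI impI)
    fix x u y v :: real
    assume "x \<in> {0..1}" "u \<in> {0..1}" "y \<in> {0..1}" "v \<in> {0..1}" "x \<le> u" "y \<le> v"
    then have "C v u - C v x - C y u + C y x \<ge> 0"
      using copula unfolding copula_def by blast
    then show "C v u - C y u - C v x + C y x \<ge> 0" by simp
  qed (use copula in \<open>auto simp: copula_def\<close>)
qed (rule clamped)

lemma zero_left: "x \<le> 0 \<Longrightarrow> C x y = 0"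
  using copula clamped[of x y] unfolding copula_def by (auto simp: clamp01_def)

lemma zero_right: "y \<le> 0 \<Longrightarrow> C x y = 0"
  using copula clamped[of x y] unfolding copula_def by (auto simp: clamp01_def)

lemma one_left: "x \<ge> 1 \<Longrightarrow> C x y = clamp01 y"
  using copula clamped[of x y] unfolding copula_def by (auto simp: clamp01_def)

lemma one_right: "y \<ge> 1 \<Longrightarrow> C x y = clamp01 x"
  using copula clamped[of x y] unfolding copula_def by (auto simp: clamp01_def)

lemma two_increasing:
  assumes "x \<le> u" "y \<le> v"
  shows "C x v - C x y \<le> C u v - C u y"
proof -
  have "C (clamp01 u) (clamp01 v) - C (clamp01 u) (clamp01 y) - C (clamp01 x) (clamp01 v)
      + C (clamp01 x) (clamp01 y) \<ge> 0"
    using copula clamp01_mono[OF assms(1)] clamp01_mono[OF assms(2)] clamp01_in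
    unfolding copula_def by blast
  then show ?thesis by (simp add: clamped)
qed

lemma mono_left: "x \<le> u \<Longrightarrow> C x y \<le> C u y"
  using two_increasing[of x u "min 0 y" y] by (simp add: zero_right)

lemma Lipschitz_left: "x \<le> u \<Longrightarrow> C u y - C x y \<le> u - x"
  using two_increasing[of x u y "max 1 y"] clamp01_Lipschitz[of x u] by (simp add: one_right)

lemma mono_right: "y \<le> v \<Longrightarrow> C x y \<le> C x v"
  using extended_copula.mono_left[OF transpose] .

lemma Lipschitz_right: "y \<le> v \<Longrightarrow> C x v - C x y \<le> v - y"
  using extended_copula.Lipschitz_left[OF transpose] .

lemma continuous: "continuous_on UNIV (\<lambda>(x, y). C x y)"
proof -
  have 1: "\<bar>C x y - C x' y\<bar> \<le> \<bar>x - x'\<bar>" for x x' y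
    using mono_left[of x x' y] mono_left[of x' x y] Lipschitz_left[of x x' y] Lipschitz_left[of x' x y]
    by (cases "x \<le> x'") auto
  have 2: "\<bar>C x y - C x y'\<bar> \<le> \<bar>y - y'\<bar>" for x y y'
    using mono_right[of y y' x] mono_right[of y' y x] Lipschitz_right[of y y' x] Lipschitz_right[of y' y x]
    by (cases "y \<le> y'") auto
  have "isCont (\<lambda>p. C (fst p) (snd p)) q" for q
    unfolding isCont_def
  proof (rule Lim_transform_bound[where g = "\<lambda>p. \<bar>fst p - fst q\<bar> + \<bar>snd p - snd q\<bar>", THEN LIM_zero_cancel])
    show "\<forall>\<^sub>F p in at q. norm (C (fst p) (snd p) - C (fst q) (snd q))
        \<le> norm (\<bar>fst p - fst q\<bar> + \<bar>snd p - snd q\<bar>)"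
    proof (intro always_eventually allI)
      fix p
      show "norm (C (fst p) (snd p) - C (fst q) (snd q)) \<le> norm (\<bar>fst p - fst q\<bar> + \<bar>snd p - snd q\<bar>)"
        using 1[of "fst p" "snd p" "fst q"] 2[of "fst q" "snd p" "snd q"] by simp
    qed
    have "((\<lambda>p. \<bar>fst p - fst q\<bar> + \<bar>snd p - snd q\<bar>) \<longlongrightarrow> \<bar>fst q - fst q\<bar> + \<bar>snd q - snd q\<bar>) (at q)"
      by (intro tendsto_intros)
    then show "((\<lambda>p. \<bar>fst p - fst q\<bar> + \<bar>snd p - snd q\<bar>) \<longlongrightarrow> 0) (at q)" by simp
  qed
  then show ?thesis
    by (simp add: continuous_on_eq_continuous_at case_prod_unfold)
qed

lemma measurable_partial1 [measurable (raw)]: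
  assumes [measurable]: "f \<in> borel_measurable M" "g \<in> borel_measurable M"
  shows "(\<lambda>w. partial1 C (f w) (g w)) \<in> borel_measurable M"
proof -
  have "(\<lambda>w. (f w, g w)) \<in> M \<rightarrow>\<^sub>M borel \<Otimes>\<^sub>M borel" by measurable
  from measurable_compose[OF this borel_measurable_deriv_parametric[OF continuous]]
  show ?thesis by (simp add: partial1_def)
qed

lemma partial2_eq: "partial2 C x y = partial1 (\<lambda>x y. C y x) y x"
  by (simp add: partial1_def partial2_def)

lemma measurable_partial2 [measurable (raw)]:
  assumes "f \<in> borel_measurable M" "g \<in> borel_measurable M"
  shows "(\<lambda>w. partial2 C (f w) (g w)) \<in> borel_measurable M"
  unfolding partial2_eq
  using extended_copula.measurable_partial1[OF transpose assms(2,1)] .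

lemma AE_partial1:
  "AE x in lborel. ((\<lambda>s. C s y) has_real_derivative partial1 C x y) (at x) \<and> partial1 C x y \<in> {0..1}"
  unfolding partial1_def
  by (rule Lipschitz_mono_fundamental_theorem(1)[of "\<lambda>s. C s y"])
    (simp_all add: mono_left Lipschitz_left)

lemma AE_partial2:
  "AE y in lborel. ((\<lambda>t. C x t) has_real_derivative partial2 C x y) (at y) \<and> partial2 C x y \<in> {0..1}"
  unfolding partial2_eq by (rule extended_copula.AE_partial1[OF transpose])

lemma nn_integral_partial1:
  "a \<le> b \<Longrightarrow> (\<integral>\<^sup>+x\<in>{a..b}. ennreal (partial1 C x y) \<partial>lborel) = ennreal (C b y - C a y)"
  unfolding partial1_def
  by (rule Lipschitz_mono_fundamental_theorem(2)[of "\<lambda>s. C s y"])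
    (simp_all add: mono_left Lipschitz_left)

lemma nn_integral_partial2:
  "a \<le> b \<Longrightarrow> (\<integral>\<^sup>+y\<in>{a..b}. ennreal (partial2 C x y) \<partial>lborel) = ennreal (C x b - C x a)"
  unfolding partial2_eq by (rule extended_copula.nn_integral_partial1[OF transpose])

lemma AE_pair_partial1:
  "AE p in lborel \<Otimes>\<^sub>M lborel. partial1 C (fst p) (snd p) \<in> {0..1}"
proof -
  have "AE y in lborel. AE x in lborel. partial1 C x y \<in> {0..1}"
    using AE_partial1 by auto
  moreover have m: "{p \<in> space (lborel \<Otimes>\<^sub>M lborel). partial1 C (fst p) (snd p) \<in> {0..1}} \<in> sets (lborel \<Otimes>\<^sub>M lborel)"
    by measurable
  ultimately have "AE x in lborel. AE y in lborel. partial1 C x y \<in> {0..1}"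
    using lborel_pair.AE_commute[OF m] by blast
  then show ?thesis
    using lborel_pair.AE_pair_iff[OF m] by blast
qed

lemma AE_pair_partial2:
  "AE p in lborel \<Otimes>\<^sub>M lborel. partial2 C (fst p) (snd p) \<in> {0..1}"
proof -
  have "AE x in lborel. AE y in lborel. partial2 C x y \<in> {0..1}"
    using AE_partial2 by auto
  moreover have m: "{p \<in> space (lborel \<Otimes>\<^sub>M lborel). partial2 C (fst p) (snd p) \<in> {0..1}} \<in> sets (lborel \<Otimes>\<^sub>M lborel)"
    by measurable
  ultimately show ?thesis
    using lborel_pair.AE_pair_iff[OF m] by blast
qed

lemma nn_integral_square_partial1:
  "(\<integral>\<^sup>+p. ennreal (partial1 C (fst p) (snd p)) * indicator ({0..1} \<times> {0..1}) p \<partial>(lborel \<Otimes>\<^sub>M lborel)) = ennreal (1 / 2)"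
proof -
  have "(\<integral>\<^sup>+p. ennreal (partial1 C (fst p) (snd p)) * indicator ({0..1} \<times> {0..1}) p \<partial>(lborel \<Otimes>\<^sub>M lborel))
     = (\<integral>\<^sup>+y. (\<integral>\<^sup>+x\<in>{0..1}. ennreal (partial1 C x y) \<partial>lborel) * indicator {0..1} y \<partial>lborel)"
    by (subst lborel_pair.nn_integral_snd[symmetric])
      (auto split: split_indicator intro!: nn_integral_cong simp: indicator_times)
  also have "\<dots> = (\<integral>\<^sup>+y. ennreal (y * indicator {0..1} y) \<partial>lborel)"
    by (intro nn_integral_cong)
      (auto simp: nn_integral_partial1 one_left zero_left clamp01_ident split: split_indicator)
  also have "\<dots> = ennreal (1 / 2)"
  proof -
    have "(\<integral>\<^sup>+y. ennreal y * indicator {0..1} y \<partial>lborel) = ennreal (1\<^sup>2 / 2 - 0\<^sup>2 / 2)"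
      by (rule nn_integral_FTC_Icc) (auto intro!: derivative_eq_intros)
    then show ?thesis by (simp add: nn_integral_set_ennreal)
  qed
  finally show ?thesis .
qed

lemma nn_integral_square_partial2:
  "(\<integral>\<^sup>+p. ennreal (partial2 C (fst p) (snd p)) * indicator ({0..1} \<times> {0..1}) p \<partial>(lborel \<Otimes>\<^sub>M lborel)) = ennreal (1 / 2)"
proof -
  have [measurable]: "(\<lambda>p. partial1 (\<lambda>x y. C y x) (f p) (g p)) \<in> borel_measurable M"
    if "f \<in> borel_measurable M" "g \<in> borel_measurable M" for f g and M :: "(real \<times> real) measure"
    using extended_copula.measurable_partial1[OF transpose that] .
  have "(\<integral>\<^sup>+p. ennreal (partial2 C (fst p) (snd p)) * indicator ({0..1} \<times> {0..1}) p \<partial>(lborel \<Otimes>\<^sub>M lborel))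
     = (\<integral>\<^sup>+p. ennreal (partial1 (\<lambda>x y. C y x) (fst p) (snd p)) * indicator ({0..1} \<times> {0..1}) p \<partial>(lborel \<Otimes>\<^sub>M lborel))"
    unfolding partial2_eq
    by (subst lborel_pair.distr_pair_swap, subst nn_integral_distr)
      (auto simp: case_prod_unfold indicator_times mult_ac intro!: nn_integral_cong)
  then show ?thesis
    using extended_copula.nn_integral_square_partial1[OF transpose] by simp
qed

text \<open>
  Let \<open>f\<close> and \<open>g\<close> be the partial derivatives. Since both have integral \<open>1/2\<close> over the square, the
  square of the norm falls short of \<open>1\<close> by the integral of \<open>f - f\<^sup>2 + g - g\<^sup>2\<close>. The integrand is
  nonnegative almost everywhere, and it vanishes almost everywhere exactly if \<open>f\<close> and \<open>g\<close> take almost only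
  the values \<open>0\<close> and \<open>1\<close>.
\<close>

lemma sobolev_norm_eq_1_iff:
  "sobolev_norm C = 1 \<longleftrightarrow>
    (AE y in lborel. y \<in> {0..1} \<longrightarrow> (AE x in lborel. x \<in> {0..1} \<longrightarrow> partial1 C x y \<in> {0, 1})) \<and>
    (AE x in lborel. x \<in> {0..1} \<longrightarrow> (AE y in lborel. y \<in> {0..1} \<longrightarrow> partial2 C x y \<in> {0, 1}))"
proof -
  let ?L = "lborel \<Otimes>\<^sub>M lborel :: (real \<times> real) measure"
  let ?i = "\<lambda>p::real \<times> real. indicator ({0..1} \<times> {0..1}) p :: real"
  let ?f = "\<lambda>p. partial1 C (fst p) (snd p)" and ?g = "\<lambda>p. partial2 C (fst p) (snd p)"
  have bd: "AE p in ?L. ?f p \<in> {0..1} \<and> ?g p \<in> {0..1}"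
    using AE_pair_partial1 AE_pair_partial2 by eventually_elim blast
  have fin: "emeasure ?L ({0..1} \<times> {0..1}) < \<infinity>"
    by (subst lborel.emeasure_pair_measure_Times) auto
  have int: "integrable ?L (\<lambda>p. ?i p * h p)"
    if [measurable]: "h \<in> borel_measurable ?L" and "AE p in ?L. \<bar>h p\<bar> \<le> 1" for h
  proof (rule Bochner_Integration.integrable_bound)
    show "integrable ?L ?i"
      using fin by (intro integrable_real_indicator) auto
    show "AE p in ?L. norm (?i p * h p) \<le> norm (?i p)"
      using that(2) by eventually_elim (auto simp: indicator_def abs_mult)
  qed auto
  have b1: "AE p in ?L. \<bar>?f p\<bar> \<le> 1" "AE p in ?L. \<bar>?g p\<bar> \<le> 1"
    using bd by (eventually_elim, simp)+
  have b2: "AE p in ?L. \<bar>(?f p)\<^sup>2\<bar> \<le> 1" "AE p in ?L. \<bar>(?g p)\<^sup>2\<bar> \<le> 1"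
    using bd by (eventually_elim, simp add: power_le_one)+
  have if1: "integrable ?L (\<lambda>p. ?i p * ?f p)" "integrable ?L (\<lambda>p. ?i p * ?g p)"
    by (intro int b1; measurable)+
  have if2: "integrable ?L (\<lambda>p. ?i p * (?f p)\<^sup>2)" "integrable ?L (\<lambda>p. ?i p * (?g p)\<^sup>2)"
    by (intro int b2; measurable)+
  have half: "(\<integral>p. ?i p * h p \<partial>?L) = 1 / 2"
    if [measurable]: "h \<in> borel_measurable ?L" and nonneg: "AE p in ?L. 0 \<le> h p"
      and h: "(\<integral>\<^sup>+p. ennreal (h p) * indicator ({0..1} \<times> {0..1}) p \<partial>?L) = ennreal (1 / 2)" for h
  proof -
    have "(\<integral>p. ?i p * h p \<partial>?L) = enn2real (\<integral>\<^sup>+p. ennreal (?i p * h p) \<partial>?L)"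
    proof (rule integral_eq_nn_integral)
      show "AE p in ?L. 0 \<le> ?i p * h p"
        using nonneg by eventually_elim simp
    qed measurable
    also have "(\<integral>\<^sup>+p. ennreal (?i p * h p) \<partial>?L) = ennreal (1 / 2)"
      using h unfolding nn_integral_set_ennreal by (simp only: mult.commute)
    also have "enn2real (ennreal (1 / 2)) = 1 / 2"
      by (rule enn2real_ennreal) simp
    finally show ?thesis .
  qed
  have nonneg: "AE p in ?L. 0 \<le> ?f p" "AE p in ?L. 0 \<le> ?g p"
    using bd by (eventually_elim, simp)+
  have v: "(\<integral>p. ?i p * ?f p \<partial>?L) = 1 / 2" "(\<integral>p. ?i p * ?g p \<partial>?L) = 1 / 2"
    by (rule half[OF _ nonneg(1) nn_integral_square_partial1], measurable)
      (rule half[OF _ nonneg(2) nn_integral_square_partial2], measurable)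
  let ?d = "\<lambda>p. ?i p * (?f p - (?f p)\<^sup>2 + (?g p - (?g p)\<^sup>2))"
  have d_eq: "?d = (\<lambda>p. (?i p * ?f p - ?i p * (?f p)\<^sup>2) + (?i p * ?g p - ?i p * (?g p)\<^sup>2))"
    by (auto simp: algebra_simps)
  have id: "integrable ?L ?d"
    unfolding d_eq by (intro Bochner_Integration.integrable_add Bochner_Integration.integrable_diff if1 if2)
  have norm: "sobolev_norm C = sqrt (\<integral>p. ?i p * (?f p)\<^sup>2 + ?i p * (?g p)\<^sup>2 \<partial>?L)"
  proof -
    have "(\<integral>p. ?i p * (?f p)\<^sup>2 + ?i p * (?g p)\<^sup>2 \<partial>?L)
       = (\<integral>y. (\<integral>x. ?i (x, y) * (?f (x, y))\<^sup>2 + ?i (x, y) * (?g (x, y))\<^sup>2 \<partial>lborel) \<partial>lborel)"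
      using lborel_pair.integral_snd[of "\<lambda>x y. ?i (x, y) * (?f (x, y))\<^sup>2 + ?i (x, y) * (?g (x, y))\<^sup>2"]
        Bochner_Integration.integrable_add[OF if2]
      by (simp add: case_prod_unfold)
    also have "\<dots> = (LBINT y:{0..1}. LBINT x:{0..1}. (partial1 C x y)\<^sup>2 + (partial2 C x y)\<^sup>2)"
      unfolding set_lebesgue_integral_def
    proof (rule Bochner_Integration.integral_cong[OF refl])
      fix y
      have "?i (x, y) * (?f (x, y))\<^sup>2 + ?i (x, y) * (?g (x, y))\<^sup>2 =
        indicator {0..1} y *\<^sub>R (indicator {0..1} x *\<^sub>R ((partial1 C x y)\<^sup>2 + (partial2 C x y)\<^sup>2))" for x
        by (cases "x \<in> {0..1}"; cases "y \<in> {0..1}") simp_all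
      then show "(\<integral>x. ?i (x, y) * (?f (x, y))\<^sup>2 + ?i (x, y) * (?g (x, y))\<^sup>2 \<partial>lborel) =
        indicator {0..1} y *\<^sub>R (\<integral>x. indicator {0..1} x *\<^sub>R ((partial1 C x y)\<^sup>2 + (partial2 C x y)\<^sup>2) \<partial>lborel)"
        by (simp only: integral_scaleR_right)
    qed
    finally show ?thesis by (simp add: sobolev_norm_def)
  qed
  have "(\<integral>p. ?d p \<partial>?L) = 1 - (\<integral>p. ?i p * (?f p)\<^sup>2 + ?i p * (?g p)\<^sup>2 \<partial>?L)"
    unfolding d_eq using if1 if2 v by simp
  then have "sobolev_norm C = 1 \<longleftrightarrow> (\<integral>p. ?d p \<partial>?L) = 0"
    unfolding norm by auto
  also have "\<dots> \<longleftrightarrow> (AE p in ?L. ?d p = 0)"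
  proof (rule integral_nonneg_eq_0_iff_AE[OF id])
    show "AE p in ?L. 0 \<le> ?d p"
      using bd
    proof eventually_elim
      case (elim p)
      have "a\<^sup>2 \<le> a" if "a \<in> {0..1}" for a :: real
        using that by (simp add: power2_eq_square mult_left_le)
      with elim have "(?f p)\<^sup>2 \<le> ?f p" "(?g p)\<^sup>2 \<le> ?g p" by blast+
      then show ?case by simp
    qed
  qed
  also have "\<dots> \<longleftrightarrow> (AE p in ?L. p \<in> {0..1} \<times> {0..1} \<longrightarrow> ?f p \<in> {0, 1} \<and> ?g p \<in> {0, 1})"
  proof -
    have "AE p in ?L. ?d p = 0 \<longleftrightarrow> (p \<in> {0..1} \<times> {0..1} \<longrightarrow> ?f p \<in> {0, 1} \<and> ?g p \<in> {0, 1})"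
      using bd
    proof eventually_elim
      case (elim p)
      have "a - a\<^sup>2 + (b - b\<^sup>2) = 0 \<longleftrightarrow> a \<in> {0, 1} \<and> b \<in> {0, 1}" if "a \<in> {0..1}" "b \<in> {0..1}" for a b :: real
      proof -
        have "a - a\<^sup>2 = a * (1 - a)" "b - b\<^sup>2 = b * (1 - b)" by (auto simp: power2_eq_square algebra_simps)
        moreover have "0 \<le> a * (1 - a)" "0 \<le> b * (1 - b)" using that by auto
        ultimately show ?thesis by (auto simp: add_nonneg_eq_0_iff)
      qed
      from this[of "?f p" "?g p"] show ?case using elim by (auto simp: indicator_def)
    qed
    then show ?thesis by (rule eventually_subst)
  qed
  also have "\<dots> \<longleftrightarrow> (AE p in ?L. p \<in> {0..1} \<times> {0..1} \<longrightarrow> ?f p \<in> {0, 1}) \<and>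
       (AE p in ?L. p \<in> {0..1} \<times> {0..1} \<longrightarrow> ?g p \<in> {0, 1})"
    by (simp only: AE_conj_iff imp_conjR)
  also have "(AE p in ?L. p \<in> {0..1} \<times> {0..1} \<longrightarrow> ?g p \<in> {0, 1}) \<longleftrightarrow>
     (AE x in lborel. AE y in lborel. x \<in> {0..1} \<longrightarrow> y \<in> {0..1} \<longrightarrow> partial2 C x y \<in> {0, 1})"
  proof -
    have "{p \<in> space ?L. fst p \<in> {0..1} \<longrightarrow> snd p \<in> {0..1} \<longrightarrow> ?g p \<in> {0, 1}} \<in> sets ?L"
      by measurable
    from lborel_pair.AE_pair_iff[OF this] show ?thesis
      by (simp only: mem_Times_iff imp_conjL)
  qed
  also have "(AE p in ?L. p \<in> {0..1} \<times> {0..1} \<longrightarrow> ?f p \<in> {0, 1}) \<longleftrightarrow>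
     (AE y in lborel. AE x in lborel. y \<in> {0..1} \<longrightarrow> x \<in> {0..1} \<longrightarrow> partial1 C x y \<in> {0, 1})"
  proof -
    have m: "{p \<in> space ?L. snd p \<in> {0..1} \<longrightarrow> fst p \<in> {0..1} \<longrightarrow> ?f p \<in> {0, 1}} \<in> sets ?L"
      by measurable
    have "(AE p in ?L. p \<in> {0..1} \<times> {0..1} \<longrightarrow> ?f p \<in> {0, 1}) \<longleftrightarrow>
        (AE p in ?L. snd p \<in> {0..1} \<longrightarrow> fst p \<in> {0..1} \<longrightarrow> ?f p \<in> {0, 1})"
      by (rule AE_cong) (auto simp only: mem_Times_iff)
    also note lborel_pair.AE_pair_iff[OF m, symmetric]
    also note lborel_pair.AE_commute[OF m]
    finally show ?thesis .
  qed
  finally show ?thesis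
    by (simp only: AE_const_imp)
qed

end

definition extend :: "(real \<Rightarrow> real \<Rightarrow> real) \<Rightarrow> real \<Rightarrow> real \<Rightarrow> real" where
  "extend C x y = C (clamp01 x) (clamp01 y)"

lemma extended_copula_extend: "copula C \<Longrightarrow> extended_copula (extend C)"
proof
  assume "copula C"
  moreover have "extend C u v = C u v" if "u \<in> {0..1}" "v \<in> {0..1}" for u v
    using that by (simp add: extend_def clamp01_ident)
  ultimately show "copula (extend C)"
    by (simp add: copula_def)
qed (simp add: extend_def clamp01_ident)

text \<open>
  The norm and the product depend only on the values on the square, although the derivatives at its
  boundary points may involve outside values.
\<close>

lemma partial1_cong_square:
  assumes "\<And>x y. x \<in> {0..1} \<Longrightarrow> y \<in> {0..1} \<Longrightarrow> C x y = D x y" "x \<in> {0<..<1}" "y \<in> {0..1}"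
  shows "partial1 C x y = partial1 D x y"
  unfolding partial1_def
proof (rule deriv_cong_ev)
  have "eventually (\<lambda>s. s \<in> {0<..<1}) (nhds x)"
    using assms(2) by (intro eventually_nhds_in_open) auto
  then show "\<forall>\<^sub>F s in nhds x. C s y = D s y"
    by eventually_elim (use assms in auto)
qed simp

lemma partial2_cong_square:
  assumes "\<And>x y. x \<in> {0..1} \<Longrightarrow> y \<in> {0..1} \<Longrightarrow> C x y = D x y" "x \<in> {0..1}" "y \<in> {0<..<1}"
  shows "partial2 C x y = partial2 D x y"
  using partial1_cong_square[of "\<lambda>x y. C y x" "\<lambda>x y. D y x" y x] assms
  by (simp add: partial1_def partial2_def)

lemma sobolev_norm_cong_square:
  assumes "\<And>x y. x \<in> {0..1} \<Longrightarrow> y \<in> {0..1} \<Longrightarrow> C x y = D x y"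
  shows "sobolev_norm C = sobolev_norm D"
proof -
  have *: "(LBINT x:{0..1}. (partial1 C x y)\<^sup>2 + (partial2 C x y)\<^sup>2)
     = (LBINT x:{0..1}. (partial1 D x y)\<^sup>2 + (partial2 D x y)\<^sup>2)" if "y \<in> {0<..<1}" for y
  proof -
    have "partial1 C x y = partial1 D x y" "partial2 C x y = partial2 D x y" if "x \<in> {0<..<1}" for x
      using that \<open>y \<in> {0<..<1}\<close>
      by (auto intro!: partial1_cong_square partial2_cong_square assms)
    then show ?thesis
      unfolding set_lebesgue_integral_def
      by (intro integral_discrete_difference[of "{0, 1}"]) (auto simp: indicator_def)
  qed
  show ?thesis
    unfolding sobolev_norm_def set_lebesgue_integral_def[of lborel _ "\<lambda>y. set_lebesgue_integral lborel _ (_ y)"]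
    by (intro arg_cong[where f = sqrt] integral_discrete_difference[of "{0, 1}"])
      (auto simp: indicator_def *)
qed

lemma copula_prod_cong_square:
  assumes "\<And>x y. x \<in> {0..1} \<Longrightarrow> y \<in> {0..1} \<Longrightarrow> C x y = C' x y"
    and "\<And>x y. x \<in> {0..1} \<Longrightarrow> y \<in> {0..1} \<Longrightarrow> D x y = D' x y"
    and "x \<in> {0..1}" "y \<in> {0..1}"
  shows "copula_prod C D x y = copula_prod C' D' x y"
proof -
  have "partial1 D t y = partial1 D' t y" "partial2 C x t = partial2 C' x t" if "t \<in> {0<..<1}" for t
    using that by (auto intro!: partial1_cong_square partial2_cong_square assms)
  then show ?thesis
    unfolding copula_prod_def set_lebesgue_integral_def
    by (intro integral_discrete_difference[of "{0, 1}"]) (auto simp: indicator_def)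
qed

section \<open>A coupling for the product of two copulas\<close>

abbreviation uniform01 :: "real measure" where
  "uniform01 \<equiv> uniform_measure lborel {0..1}"

interpretation uniform01: prob_space uniform01
  by (rule prob_space_uniform_measure) auto

interpretation uniform01_pair: pair_prob_space uniform01 uniform01 ..

interpretation uniform01_triple: pair_prob_space uniform01 "uniform01 \<Otimes>\<^sub>M uniform01" ..

lemma sets_uniform01_triple [measurable_cong]:
  "sets (uniform01 \<Otimes>\<^sub>M (uniform01 \<Otimes>\<^sub>M uniform01)) = sets (borel \<Otimes>\<^sub>M (borel \<Otimes>\<^sub>M borel))"
  by (intro sets_pair_measure_cong) auto

text \<open>
  Given the first coordinate \<open>t\<close>, the events \<open>z \<le> \<alpha> t\<close> and \<open>w \<le> \<beta> t\<close> are independent with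
  probabilities \<open>\<alpha> t\<close> and \<open>\<beta> t\<close>. This is how conditional independence enters the coupling.
\<close>

lemma emeasure_below_graphs:
  assumes [measurable]: "\<alpha> \<in> borel_measurable borel" "\<beta> \<in> borel_measurable borel" "S \<in> sets borel"
    and \<alpha>: "AE t in lborel. \<alpha> t \<in> {0..1}" and \<beta>: "AE t in lborel. \<beta> t \<in> {0..1}"
  shows "emeasure (uniform01 \<Otimes>\<^sub>M (uniform01 \<Otimes>\<^sub>M uniform01))
      {\<omega>. fst (snd \<omega>) \<le> \<alpha> (fst \<omega>) \<and> snd (snd \<omega>) \<le> \<beta> (fst \<omega>) \<and> fst \<omega> \<in> S}
    = (\<integral>\<^sup>+t\<in>{0..1} \<inter> S. ennreal (\<alpha> t * \<beta> t) \<partial>lborel)"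
proof -
  let ?A = "{\<omega>. fst (snd \<omega>) \<le> \<alpha> (fst \<omega>) \<and> snd (snd \<omega>) \<le> \<beta> (fst \<omega>) \<and> fst \<omega> \<in> S}"
  have "{\<omega> \<in> space (borel \<Otimes>\<^sub>M (borel \<Otimes>\<^sub>M borel)). fst (snd \<omega>) \<le> \<alpha> (fst \<omega>) \<and>
      snd (snd \<omega>) \<le> \<beta> (fst \<omega>) \<and> fst \<omega> \<in> S} \<in> sets (borel \<Otimes>\<^sub>M (borel \<Otimes>\<^sub>M borel))"
    by measurable
  then have A: "?A \<in> sets (uniform01 \<Otimes>\<^sub>M (uniform01 \<Otimes>\<^sub>M uniform01))"
    by (simp add: sets_uniform01_triple space_pair_measure)
  have below: "emeasure uniform01 {..a} = ennreal a" if "a \<in> {0..1}" for a :: real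
  proof -
    have "{0..1} \<inter> {..a} = {0..a}" using that by auto
    then show ?thesis using that by (simp add: divide_ennreal_def)
  qed
  have "emeasure (uniform01 \<Otimes>\<^sub>M (uniform01 \<Otimes>\<^sub>M uniform01)) ?A
      = (\<integral>\<^sup>+t. emeasure (uniform01 \<Otimes>\<^sub>M uniform01) (Pair t -` ?A) \<partial>uniform01)"
    by (rule uniform01_pair.P.emeasure_pair_measure_alt[OF A])
  also have "\<dots> = (\<integral>\<^sup>+t. emeasure uniform01 {..\<alpha> t} * emeasure uniform01 {..\<beta> t} * indicator S t \<partial>uniform01)"
  proof (intro nn_integral_cong)
    fix t
    have "Pair t -` ?A = (if t \<in> S then {..\<alpha> t} \<times> {..\<beta> t} else {})" by auto
    then show "emeasure (uniform01 \<Otimes>\<^sub>M uniform01) (Pair t -` ?A)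
       = emeasure uniform01 {..\<alpha> t} * emeasure uniform01 {..\<beta> t} * indicator S t"
      by (auto simp: uniform01.emeasure_pair_measure_Times)
  qed
  also have "\<dots> = (\<integral>\<^sup>+t. ennreal (\<alpha> t * \<beta> t) * indicator S t \<partial>uniform01)"
  proof (rule nn_integral_cong_AE)
    show "AE t in uniform01. emeasure uniform01 {..\<alpha> t} * emeasure uniform01 {..\<beta> t} * indicator S t
        = ennreal (\<alpha> t * \<beta> t) * indicator S t"
    proof (rule AE_uniform_measureI)
      show "AE t in lborel. t \<in> {0..1} \<longrightarrow> emeasure uniform01 {..\<alpha> t} * emeasure uniform01 {..\<beta> t} * indicator S t
        = ennreal (\<alpha> t * \<beta> t) * indicator S t"
        using \<alpha> \<beta> by eventually_elim (simp only: below ennreal_mult'[symmetric], simp add: ennreal_mult)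
    qed simp
  qed
  also have "\<dots> = (\<integral>\<^sup>+t\<in>{0..1} \<inter> S. ennreal (\<alpha> t * \<beta> t) \<partial>lborel)"
    by (subst nn_integral_uniform_measure)
      (auto simp: divide_ennreal_def intro!: nn_integral_cong split: split_indicator)
  finally show ?thesis .
qed

text \<open>
  The variable is the infimum of the rational levels \<open>q\<close> in the unit interval whose event \<open>A q\<close> has
  occurred. For \<open>0 < x \<le> 1\<close>, the event \<open>X < x\<close> is then the union of the events of the rational levels
  in the interval from \<open>0\<close> to \<open>x\<close>. Up to a null set this union is contained in \<open>A x\<close>, and both have
  probability \<open>x\<close>.
\<close>

lemma (in prob_space) variable_with_level_sets:
  assumes A [measurable]: "\<And>q::real. A q \<in> events"
    and mono: "\<And>p q. p \<le> q \<Longrightarrow> AE \<omega> in M. \<omega> \<in> A p \<longrightarrow> \<omega> \<in> A q"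
    and prob_A: "\<And>q. prob (A q) = clamp01 q"
  obtains X where "X \<in> borel_measurable M" "\<And>x. AE \<omega> in M. X \<omega> < x \<longleftrightarrow> \<omega> \<in> A x"
proof
  let ?Q = "\<rat> \<inter> {0..1::real}"
  \<comment> \<open>A level whose event has not occurred contributes \<open>1\<close>, the greatest level, and so never lowers the
    infimum below a threshold \<open>x \<le> 1\<close>.\<close>
  define X where "X = (\<lambda>\<omega>. INF q\<in>?Q. if \<omega> \<in> A q then q else 1)"
  have Q: "countable ?Q" "?Q \<noteq> {}" using countable_rat by (auto intro!: exI[of _ 0])
  have bdd: "bdd_below ((\<lambda>q. if \<omega> \<in> A q then q else 1) ` ?Q)" for \<omega>
    by (rule bdd_belowI[of _ 0]) auto
  show "X \<in> borel_measurable M"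
    unfolding X_def using Q bdd by (intro borel_measurable_cINF) auto
  have X_less: "X \<omega> < x \<longleftrightarrow> (\<exists>q\<in>?Q. (if \<omega> \<in> A q then q else 1) < x)" for \<omega> x
    unfolding X_def using cInf_less_iff[OF _ bdd[of \<omega>], of x] Q(2) by auto
  fix x :: real
  consider "x \<le> 0" | "0 < x" "x \<le> 1" | "1 < x" by linarith
  then show "AE \<omega> in M. X \<omega> < x \<longleftrightarrow> \<omega> \<in> A x"
  proof cases
    case 1
    then have "prob (A x) = 0" by (simp add: prob_A clamp01_def)
    then have "AE \<omega> in M. \<omega> \<notin> A x" by (simp add: prob_eq_0)
    then show ?thesis
      by eventually_elim (use 1 in \<open>auto simp: X_less split: if_splits\<close>)
  next
    case 2
    define S where "S = (\<Union>q\<in>{q\<in>?Q. q < x}. A q)"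
    have cS: "countable {q\<in>?Q. q < x}" using Q(1) by (rule countable_subset[rotated]) auto
    have S[measurable]: "S \<in> events" unfolding S_def using cS by auto
    have "AE \<omega> in M. \<forall>q\<in>{q\<in>?Q. q < x}. \<omega> \<in> A q \<longrightarrow> \<omega> \<in> A x"
      using cS mono by (subst AE_ball_countable) auto
    then have sub: "AE \<omega> in M. \<omega> \<in> S \<longrightarrow> \<omega> \<in> A x"
      by eventually_elim (auto simp: S_def)
    have ge: "x \<le> prob S"
    proof (rule ccontr)
      assume "\<not> x \<le> prob S"
      then obtain q where q: "q \<in> \<rat>" "prob S < q" "q < x"
        using Rats_dense_in_real[of "prob S" x] by auto
      have "0 \<le> q" using q measure_nonneg[of M S] by linarith
      with q 2 have "A q \<subseteq> S" by (auto simp: S_def)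
      then have "clamp01 q \<le> prob S"
        using finite_measure_mono[of "A q" S] by (simp add: prob_A)
      with q 2 \<open>0 \<le> q\<close> show False by (auto simp: clamp01_def)
    qed
    have "prob S = prob (A x \<inter> S)"
      by (rule finite_measure_eq_AE) (use sub in auto)
    then have "prob (A x - S) = 0"
      using ge 2 finite_measure_Diff'[of "A x" S] measure_nonneg[of M "A x - S"]
      by (simp add: prob_A clamp01_def)
    then have "AE \<omega> in M. \<omega> \<notin> A x - S" by (simp add: prob_eq_0)
    with sub show ?thesis
    proof eventually_elim
      case (elim \<omega>)
      have "X \<omega> < x \<longleftrightarrow> \<omega> \<in> S"
        using 2 by (auto simp: X_less S_def split: if_splits)
      then show ?case using elim by auto
    qed
  next
    case 3
    then have "prob (A x) = 1" by (simp add: prob_A clamp01_def)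
    then have "AE \<omega> in M. \<omega> \<in> A x" by (simp add: prob_eq_1)
    then show ?thesis
      by eventually_elim (use 3 in \<open>auto simp: X_less intro!: bexI[of _ 1]\<close>)
  qed
qed

lemma (in extended_copula) AE_partial2_mono:
  assumes "p \<le> q"
  shows "AE t in lborel. partial2 C p t \<le> partial2 C q t"
  using AE_partial2[of p] AE_partial2[of q]
proof eventually_elim
  case (elim t)
  then have der: "((\<lambda>t. C q t - C p t) has_real_derivative (partial2 C q t - partial2 C p t)) (at t)"
    by (intro DERIV_diff) auto
  have "mono_on UNIV (\<lambda>t. C q t - C p t)"
    using two_increasing[OF assms] by (auto intro!: mono_onI simp: algebra_simps)
  from mono_on_imp_deriv_nonneg[OF this der] show ?case by simp
qed

lemma (in extended_copula) nn_integral_partial2_below: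
  "(\<integral>\<^sup>+t\<in>{0..1} \<inter> {..<b}. ennreal (partial2 C x t) \<partial>lborel) = ennreal (C x b)"
proof -
  have "(\<integral>\<^sup>+t\<in>{0..1} \<inter> {..<b}. ennreal (partial2 C x t) \<partial>lborel)
      = (\<integral>\<^sup>+t\<in>{0..clamp01 b}. ennreal (partial2 C x t) \<partial>lborel)"
  proof (rule nn_integral_cong_AE)
    show "AE t in lborel. ennreal (partial2 C x t) * indicator ({0..1} \<inter> {..<b}) t =
        ennreal (partial2 C x t) * indicator {0..clamp01 b} t"
      using AE_lborel_singleton[of b] AE_lborel_singleton[of 0]
      by eventually_elim (auto simp: clamp01_def indicator_def)
  qed
  also have "\<dots> = ennreal (C x (clamp01 b))"
    by (simp add: nn_integral_partial2 zero_right)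
  also have "C x (clamp01 b) = C x b"
    using clamped[of x "clamp01 b"] clamped[of x b] by (simp add: clamp01_ident)
  finally show ?thesis .
qed

lemma (in extended_copula) nonneg: "0 \<le> C x y"
  using mono_left[of "min 0 x" x y] by (simp add: zero_left)

text \<open>
  Draw \<open>(t, z, w)\<close> uniformly from the cube, put \<open>T = t\<close>, and obtain \<open>X\<close> and \<open>Y\<close> by inverting the
  conditional distribution functions \<open>\<lambda>x. \<partial>\<^sub>2U(x, t)\<close> at \<open>z\<close> and \<open>\<lambda>y. \<partial>\<^sub>1V(t, y)\<close> at \<open>w\<close>. Up to
  null sets, \<open>X < x\<close> is then the event \<open>A x\<close> of all outcomes with \<open>z \<le> \<partial>\<^sub>2U(x, t)\<close>, and \<open>Y < y\<close> is the
  analogous event \<open>B y\<close>.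
\<close>

theorem copula_prod_coupling:
  assumes "extended_copula U" "extended_copula V"
  obtains M :: "(real \<times> real \<times> real) measure" and X T Y where "prob_space M"
    "X \<in> borel_measurable M" "T \<in> borel_measurable M" "Y \<in> borel_measurable M"
    "\<And>x t. measure M {\<omega> \<in> space M. X \<omega> < x \<and> T \<omega> < t} = U x t"
    "\<And>t y. measure M {\<omega> \<in> space M. T \<omega> < t \<and> Y \<omega> < y} = V t y"
    "\<And>x y. measure M {\<omega> \<in> space M. X \<omega> < x \<and> Y \<omega> < y} = copula_prod U V x y"
proof -
  interpret U: extended_copula U by fact
  interpret V: extended_copula V by fact
  interpret V': extended_copula "\<lambda>x y. V y x" by (rule V.transpose)
  have V'_partial2: "partial2 (\<lambda>x y. V y x) y t = partial1 V t y" for y t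
    by (simp add: partial1_def partial2_def)
  define M where "M = uniform01 \<Otimes>\<^sub>M (uniform01 \<Otimes>\<^sub>M uniform01)"
  have sets_M [measurable_cong]: "sets M = sets (borel \<Otimes>\<^sub>M (borel \<Otimes>\<^sub>M borel))"
    unfolding M_def by (rule sets_uniform01_triple)
  have space_M [simp]: "space M = UNIV"
    by (simp add: M_def space_pair_measure)
  interpret M: prob_space M
    unfolding M_def by (rule uniform01_triple.P.prob_space_axioms)
  define A where "A = (\<lambda>x. {\<omega> :: real \<times> real \<times> real. fst (snd \<omega>) \<le> partial2 U x (fst \<omega>)})"
  define B where "B = (\<lambda>y. {\<omega> :: real \<times> real \<times> real. snd (snd \<omega>) \<le> partial1 V (fst \<omega>) y})"
  have sets_Collect: "{\<omega> \<in> space M. P \<omega>} \<in> sets M \<Longrightarrow> {\<omega>. P \<omega>} \<in> sets M" for P by simp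
  have A[measurable]: "A x \<in> sets M" for x
    unfolding A_def by (rule sets_Collect) measurable
  have B[measurable]: "B y \<in> sets M" for y
    unfolding B_def by (rule sets_Collect) measurable
  have AT_sets[measurable]: "{\<omega> \<in> A x. fst \<omega> < t} \<in> sets M" for x t
  proof -
    have "{\<omega> \<in> space M. \<omega> \<in> A x \<and> fst \<omega> < t} \<in> sets M" by measurable
    then show ?thesis by simp
  qed
  have BT_sets[measurable]: "{\<omega> \<in> B y. fst \<omega> < t} \<in> sets M" for y t
  proof -
    have "{\<omega> \<in> space M. \<omega> \<in> B y \<and> fst \<omega> < t} \<in> sets M" by measurable
    then show ?thesis by simp
  qed
  \<comment> \<open>Only \<open>t\<close> in the unit interval matters, as the first coordinate is uniform there.\<close>
  have AE_fst: "AE \<omega> in M. P (fst \<omega>)"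
    if [measurable]: "Measurable.pred borel P" and P: "AE t in lborel. t \<in> {0..1} \<longrightarrow> P t" for P
  proof -
    have "AE t in uniform01. P t"
      by (rule AE_uniform_measureI[OF _ P]) simp
    then have "AE t in uniform01. AE z in uniform01 \<Otimes>\<^sub>M uniform01. P (fst (t, z))" by simp
    then show ?thesis
      unfolding M_def by (rule uniform01_triple.AE_pair_measure[rotated]) measurable
  qed
  have "emeasure M {\<omega>. fst (snd \<omega>) \<le> 1 \<and> snd (snd \<omega>) \<le> 1 \<and> fst \<omega> \<in> UNIV} = 1"
    unfolding M_def by (subst emeasure_below_graphs) auto
  then have prob_1: "M.prob {\<omega> \<in> space M. fst (snd \<omega>) \<le> 1 \<and> snd (snd \<omega>) \<le> 1} = 1"
    by (simp add: measure_def)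
  have events: "{\<omega> \<in> space M. fst (snd \<omega>) \<le> 1 \<and> snd (snd \<omega>) \<le> 1} \<in> sets M"
    by measurable
  have le_1: "AE \<omega> in M. fst (snd \<omega>) \<le> 1 \<and> snd (snd \<omega>) \<le> 1"
    using M.prob_Collect_eq_1[OF events] prob_1 by blast
  have AB: "M.prob (A x \<inter> B y) = copula_prod U V x y" for x y
  proof -
    have "A x \<inter> B y = {\<omega>. fst (snd \<omega>) \<le> partial2 U x (fst \<omega>) \<and> snd (snd \<omega>) \<le> partial1 V (fst \<omega>) y \<and> fst \<omega> \<in> UNIV}"
      by (auto simp: A_def B_def)
    moreover have "emeasure M \<dots> = (\<integral>\<^sup>+t\<in>{0..1} \<inter> UNIV. ennreal (partial2 U x t * partial1 V t y) \<partial>lborel)"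
      unfolding M_def using U.AE_partial2[of x] V.AE_partial1[of y]
      by (intro emeasure_below_graphs) auto
    moreover have "\<dots> = (\<integral>\<^sup>+t. ennreal (indicator {0..1} t *\<^sub>R (partial2 U x t * partial1 V t y)) \<partial>lborel)"
      by (intro nn_integral_cong) (simp add: indicator_def)
    ultimately have "M.prob (A x \<inter> B y) = enn2real (\<integral>\<^sup>+t. ennreal (indicator {0..1} t *\<^sub>R (partial2 U x t * partial1 V t y)) \<partial>lborel)"
      by (simp only: measure_def)
    also have "\<dots> = copula_prod U V x y"
      unfolding copula_prod_def set_lebesgue_integral_def
    proof (rule integral_eq_nn_integral[symmetric])
      show "AE t in lborel. 0 \<le> indicat_real {0..1} t *\<^sub>R (partial2 U x t * partial1 V t y)"
        using U.AE_partial2[of x] V.AE_partial1[of y] by eventually_elim auto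
    qed simp
    finally show ?thesis .
  qed
  have AT: "M.prob {\<omega> \<in> A x. fst \<omega> < t} = U x t" for x t
  proof -
    have "M.prob {\<omega> \<in> A x. fst \<omega> < t}
      = M.prob {\<omega>. fst (snd \<omega>) \<le> partial2 U x (fst \<omega>) \<and> snd (snd \<omega>) \<le> 1 \<and> fst \<omega> \<in> {..<t}}"
    proof (rule M.finite_measure_eq_AE)
      show "AE \<omega> in M. \<omega> \<in> {\<omega> \<in> A x. fst \<omega> < t} \<longleftrightarrow>
        \<omega> \<in> {\<omega>. fst (snd \<omega>) \<le> partial2 U x (fst \<omega>) \<and> snd (snd \<omega>) \<le> 1 \<and> fst \<omega> \<in> {..<t}}"
        using le_1 by eventually_elim (auto simp: A_def)
      show "{\<omega>. fst (snd \<omega>) \<le> partial2 U x (fst \<omega>) \<and> snd (snd \<omega>) \<le> 1 \<and> fst \<omega> \<in> {..<t}} \<in> sets M"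
        by (rule sets_Collect) measurable
    qed (rule AT_sets)
    also have "\<dots> = enn2real (\<integral>\<^sup>+s\<in>{0..1} \<inter> {..<t}. ennreal (partial2 U x s * 1) \<partial>lborel)"
      unfolding M_def measure_def using U.AE_partial2[of x]
      by (subst emeasure_below_graphs) auto
    also have "\<dots> = U x t"
      by (simp add: U.nn_integral_partial2_below U.nonneg)
    finally show ?thesis .
  qed
  have BT: "M.prob {\<omega> \<in> B y. fst \<omega> < t} = V t y" for y t
  proof -
    have "M.prob {\<omega> \<in> B y. fst \<omega> < t}
      = M.prob {\<omega>. fst (snd \<omega>) \<le> 1 \<and> snd (snd \<omega>) \<le> partial1 V (fst \<omega>) y \<and> fst \<omega> \<in> {..<t}}"
    proof (rule M.finite_measure_eq_AE)
      show "AE \<omega> in M. \<omega> \<in> {\<omega> \<in> B y. fst \<omega> < t} \<longleftrightarrow>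
        \<omega> \<in> {\<omega>. fst (snd \<omega>) \<le> 1 \<and> snd (snd \<omega>) \<le> partial1 V (fst \<omega>) y \<and> fst \<omega> \<in> {..<t}}"
        using le_1 by eventually_elim (auto simp: B_def)
      show "{\<omega>. fst (snd \<omega>) \<le> 1 \<and> snd (snd \<omega>) \<le> partial1 V (fst \<omega>) y \<and> fst \<omega> \<in> {..<t}} \<in> sets M"
        by (rule sets_Collect) measurable
    qed (rule BT_sets)
    also have "\<dots> = enn2real (\<integral>\<^sup>+s\<in>{0..1} \<inter> {..<t}. ennreal (1 * partial1 V s y) \<partial>lborel)"
      unfolding M_def measure_def using V.AE_partial1[of y]
      by (subst emeasure_below_graphs) auto
    also have "\<dots> = V t y"
      using V'.nn_integral_partial2_below[where b = t and x = y] by (simp add: V'_partial2 V.nonneg)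
    finally show ?thesis .
  qed
  have T_less_2: "AE \<omega> in M. fst \<omega> < 2"
    by (rule AE_fst) auto
  obtain X where X[measurable]: "X \<in> borel_measurable M" and XA: "\<And>x. AE \<omega> in M. X \<omega> < x \<longleftrightarrow> \<omega> \<in> A x"
  proof (rule M.variable_with_level_sets[of A])
    fix p q :: real assume "p \<le> q"
    have "AE \<omega> in M. partial2 U p (fst \<omega>) \<le> partial2 U q (fst \<omega>)"
      using U.AE_partial2_mono[OF \<open>p \<le> q\<close>] by (intro AE_fst) auto
    then show "AE \<omega> in M. \<omega> \<in> A p \<longrightarrow> \<omega> \<in> A q"
      by eventually_elim (auto simp: A_def)
  next
    fix q
    have "M.prob (A q) = M.prob {\<omega> \<in> A q. fst \<omega> < 2}"
      by (rule M.finite_measure_eq_AE) (use T_less_2 in auto)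
    then show "M.prob (A q) = clamp01 q"
      by (simp add: AT U.one_right)
  qed auto
  obtain Y where Y[measurable]: "Y \<in> borel_measurable M" and YB: "\<And>y. AE \<omega> in M. Y \<omega> < y \<longleftrightarrow> \<omega> \<in> B y"
  proof (rule M.variable_with_level_sets[of B])
    fix p q :: real assume "p \<le> q"
    have "AE \<omega> in M. partial1 V (fst \<omega>) p \<le> partial1 V (fst \<omega>) q"
      using V'.AE_partial2_mono[OF \<open>p \<le> q\<close>] unfolding V'_partial2 by (intro AE_fst) auto
    then show "AE \<omega> in M. \<omega> \<in> B p \<longrightarrow> \<omega> \<in> B q"
      by eventually_elim (auto simp: B_def)
  next
    fix q
    have "M.prob (B q) = M.prob {\<omega> \<in> B q. fst \<omega> < 2}"
      by (rule M.finite_measure_eq_AE) (use T_less_2 in auto)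
    then show "M.prob (B q) = clamp01 q"
      by (simp add: BT V.one_left)
  qed auto
  show ?thesis
  proof
    show "prob_space M" by (rule M.prob_space_axioms)
    show "X \<in> borel_measurable M" "fst \<in> borel_measurable M" "Y \<in> borel_measurable M"
      by measurable
    fix x t y
    have "M.prob {\<omega> \<in> space M. X \<omega> < x \<and> fst \<omega> < t} = M.prob {\<omega> \<in> A x. fst \<omega> < t}"
    proof (rule M.finite_measure_eq_AE)
      show "AE \<omega> in M. \<omega> \<in> {\<omega> \<in> space M. X \<omega> < x \<and> fst \<omega> < t} \<longleftrightarrow> \<omega> \<in> {\<omega> \<in> A x. fst \<omega> < t}"
        using XA[of x] by eventually_elim auto
    qed measurable
    then show "M.prob {\<omega> \<in> space M. X \<omega> < x \<and> fst \<omega> < t} = U x t" by (simp add: AT)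
    have "M.prob {\<omega> \<in> space M. fst \<omega> < t \<and> Y \<omega> < y} = M.prob {\<omega> \<in> B y. fst \<omega> < t}"
    proof (rule M.finite_measure_eq_AE)
      show "AE \<omega> in M. \<omega> \<in> {\<omega> \<in> space M. fst \<omega> < t \<and> Y \<omega> < y} \<longleftrightarrow> \<omega> \<in> {\<omega> \<in> B y. fst \<omega> < t}"
        using YB[of y] by eventually_elim auto
    qed measurable
    then show "M.prob {\<omega> \<in> space M. fst \<omega> < t \<and> Y \<omega> < y} = V t y" by (simp add: BT)
    have "M.prob {\<omega> \<in> space M. X \<omega> < x \<and> Y \<omega> < y} = M.prob (A x \<inter> B y)"
    proof (rule M.finite_measure_eq_AE)
      show "AE \<omega> in M. \<omega> \<in> {\<omega> \<in> space M. X \<omega> < x \<and> Y \<omega> < y} \<longleftrightarrow> \<omega> \<in> A x \<inter> B y"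
        using XA[of x] YB[of y] by eventually_elim auto
    qed measurable
    then show "M.prob {\<omega> \<in> space M. X \<omega> < x \<and> Y \<omega> < y} = copula_prod U V x y" by (simp add: AB)
  qed
qed

lemma measure_eqI_below:
  fixes M N :: "real measure"
  assumes sets: "sets M = sets borel" "sets N = sets borel"
    and fin: "\<And>x. emeasure M {..<x} < \<infinity>"
    and eq: "\<And>x. emeasure M {..<x} = emeasure N {..<x}"
  shows "M = N"
proof (rule measure_eqI_generator_eq_countable)
  let ?E = "range lessThan :: real set set"
  show "Int_stable ?E"
  proof (rule Int_stableI)
    fix A B :: "real set" assume "A \<in> ?E" "B \<in> ?E"
    then obtain a b where "A = {..<a}" "B = {..<b}" by blast
    then have "A \<inter> B = {..<min a b}" by auto
    then show "A \<inter> B \<in> ?E" by blast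
  qed
  show "?E \<subseteq> Pow UNIV" "sets M = sigma_sets UNIV ?E" "sets N = sigma_sets UNIV ?E"
    unfolding sets borel_Iio by auto
  show "lessThan ` \<nat> \<subseteq> ?E" "(\<Union>i\<in>\<nat>. {..<i::real}) = UNIV"
    "\<And>a. a \<in> lessThan ` (\<nat> :: real set) \<Longrightarrow> emeasure M a \<noteq> \<infinity>"
    using fin reals_Archimedean2 by (auto simp: less_top Nats_def)
qed (auto intro: eq simp: Nats_def)

section \<open>Random variables that determine each other\<close>

text \<open>
  Up to null sets, the events decided by \<open>Y\<close> are among those decided by \<open>X\<close>. Stating this with
  sets, rather than as the existence of a function \<open>h\<close> with \<open>Y = h \<circ> X\<close> almost surely, lets it be
  checked on a generator of the Borel sets.
\<close>

definition determines :: "'a measure \<Rightarrow> ('a \<Rightarrow> real) \<Rightarrow> ('a \<Rightarrow> real) \<Rightarrow> bool" where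
  "determines M X Y \<longleftrightarrow>
     (\<forall>B\<in>sets borel. \<exists>E\<in>sets borel. AE \<omega> in M. Y \<omega> \<in> B \<longleftrightarrow> X \<omega> \<in> E)"

lemma determines_trans:
  assumes "determines M X Y" "determines M Y Z"
  shows "determines M X Z"
  unfolding determines_def
proof
  fix B :: "real set" assume "B \<in> sets borel"
  then obtain E where "E \<in> sets borel" and E: "AE \<omega> in M. Z \<omega> \<in> B \<longleftrightarrow> Y \<omega> \<in> E"
    using assms(2) unfolding determines_def by blast
  then obtain F where F: "F \<in> sets borel" "AE \<omega> in M. Y \<omega> \<in> E \<longleftrightarrow> X \<omega> \<in> F"
    using assms(1) unfolding determines_def by blast
  from E F(2) have "AE \<omega> in M. Z \<omega> \<in> B \<longleftrightarrow> X \<omega> \<in> F"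
    by eventually_elim simp
  with F(1) show "\<exists>E\<in>sets borel. AE \<omega> in M. Z \<omega> \<in> B \<longleftrightarrow> X \<omega> \<in> E" by blast
qed

lemma determines_generator:
  assumes basic: "\<And>y. \<exists>E\<in>sets borel. AE \<omega> in M. Y \<omega> < y \<longleftrightarrow> X \<omega> \<in> E"
  shows "determines M X Y"
  unfolding determines_def
proof
  fix B :: "real set" assume "B \<in> sets borel"
  then have "B \<in> sigma_sets UNIV (range lessThan)"
    by (simp add: borel_Iio)
  then show "\<exists>E\<in>sets borel. AE \<omega> in M. Y \<omega> \<in> B \<longleftrightarrow> X \<omega> \<in> E"
  proof induction
    case (Basic B)
    then show ?case using basic by auto
  next
    case Empty
    show ?case by (rule bexI[of _ "{}"]) auto
  next
    case (Compl B)
    then obtain E where "E \<in> sets borel" and E: "AE \<omega> in M. Y \<omega> \<in> B \<longleftrightarrow> X \<omega> \<in> E" by blast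
    then show ?case by (intro bexI[of _ "- E"]) auto
  next
    case (Union B)
    then have "\<forall>i. \<exists>E. E \<in> sets borel \<and> (AE \<omega> in M. Y \<omega> \<in> B i \<longleftrightarrow> X \<omega> \<in> E)"
      by blast
    from choice[OF this] obtain E where E: "\<And>i. E i \<in> sets borel"
      "\<And>i. AE \<omega> in M. Y \<omega> \<in> B i \<longleftrightarrow> X \<omega> \<in> E i" by blast
    from E(2) have "AE \<omega> in M. \<forall>i. Y \<omega> \<in> B i \<longleftrightarrow> X \<omega> \<in> E i"
      by (simp add: AE_all_countable)
    then have "AE \<omega> in M. Y \<omega> \<in> (\<Union>i. B i) \<longleftrightarrow> X \<omega> \<in> (\<Union>i. E i)"
      by eventually_elim auto
    then show ?case using E(1) by (intro bexI[of _ "\<Union>i. E i"]) auto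
  qed
qed

section \<open>Norm one as mutual determination\<close>

text \<open>
  A pair of random variables with joint distribution function \<open>C\<close>. The inequalities are strict
  because the level sets of the variables that are constructed above are known in this form; as \<open>C\<close> is
  continuous, this makes no difference to the distribution.
\<close>

locale coupling = prob_space M + extended_copula C
  for M :: "'a measure" and X Y :: "'a \<Rightarrow> real" and C +
  assumes X [measurable]: "X \<in> borel_measurable M"
    and Y [measurable]: "Y \<in> borel_measurable M"
    and joint: "prob {\<omega> \<in> space M. X \<omega> < x \<and> Y \<omega> < y} = C x y"
begin

lemma swap: "coupling M Y X (\<lambda>x y. C y x)"
proof -
  interpret C': extended_copula "\<lambda>x y. C y x" by (rule transpose)
  show ?thesis
    by unfold_locales (auto simp: joint[symmetric] conj_commute)
qed

lemma AE_right_bound: "AE \<omega> in M. Y \<omega> < 2"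
proof -
  have "prob {\<omega> \<in> space M. X \<omega> < 2 \<and> Y \<omega> < 2} = 1"
    by (simp add: joint one_left clamp01_def)
  moreover have ev: "{\<omega> \<in> space M. X \<omega> < 2 \<and> Y \<omega> < 2} \<in> events" by measurable
  ultimately have "AE \<omega> in M. X \<omega> < 2 \<and> Y \<omega> < 2"
    using prob_Collect_eq_1[OF ev] by blast
  then show ?thesis by simp
qed

lemma marginal_left: "prob {\<omega> \<in> space M. X \<omega> < x} = clamp01 x"
proof -
  have "prob {\<omega> \<in> space M. X \<omega> < x} = prob {\<omega> \<in> space M. X \<omega> < x \<and> Y \<omega> < 2}"
    by (rule finite_measure_eq_AE) (measurable, use AE_right_bound in auto)
  then show ?thesis by (simp add: joint one_right)
qed

lemma marginal_right: "prob {\<omega> \<in> space M. Y \<omega> < y} = clamp01 y"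
  using coupling.marginal_left[OF swap] .

lemma partial1_left_of_square: "s < 0 \<Longrightarrow> partial1 C s y = 0"
  unfolding partial1_def
  by (rule DERIV_imp_deriv, rule has_field_derivative_transform_within_open[of "\<lambda>_. 0" 0 s "{..<0}"])
    (auto simp: zero_left)

text \<open>
  The derivative \<open>\<partial>\<^sub>1C(x, y)\<close> is the density in \<open>x\<close> of the law of \<open>X\<close> on the event \<open>Y < y\<close>: the measures
  agree on all half-lines by the fundamental theorem.
\<close>

lemma emeasure_joint:
  assumes A: "A \<in> sets borel"
  shows "emeasure M {\<omega> \<in> space M. X \<omega> \<in> A \<and> Y \<omega> < y} = (\<integral>\<^sup>+x\<in>A. ennreal (partial1 C x y) \<partial>lborel)"
proof -
  let ?D = "density M (indicator {\<omega> \<in> space M. Y \<omega> < y})"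
  have D: "emeasure (distr ?D borel X) A = emeasure M {\<omega> \<in> space M. X \<omega> \<in> A \<and> Y \<omega> < y}"
    if [measurable]: "A \<in> sets borel" for A
  proof -
    have "emeasure (distr ?D borel X) A = emeasure ?D (X -` A \<inter> space M)"
      by (subst emeasure_distr) auto
    also have "\<dots> = emeasure M ({\<omega> \<in> space M. Y \<omega> < y} \<inter> (X -` A \<inter> space M))"
      by (subst emeasure_density) (auto simp: indicator_inter_arith[symmetric])
    also have "{\<omega> \<in> space M. Y \<omega> < y} \<inter> (X -` A \<inter> space M) = {\<omega> \<in> space M. X \<omega> \<in> A \<and> Y \<omega> < y}"
      by auto
    finally show ?thesis .
  qed
  let ?N = "density lborel (\<lambda>x. ennreal (partial1 C x y))"
  have N: "emeasure ?N A = (\<integral>\<^sup>+x\<in>A. ennreal (partial1 C x y) \<partial>lborel)" if "A \<in> sets borel" for A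
    using that by (intro emeasure_density) auto
  have "distr ?D borel X = ?N"
  proof (rule measure_eqI_below)
    fix x
    have D': "emeasure (distr ?D borel X) {..<x} = ennreal (C x y)"
      by (subst D) (auto simp: emeasure_eq_measure joint)
    then show "emeasure (distr ?D borel X) {..<x} < \<infinity>" by simp
    have "(\<integral>\<^sup>+s\<in>{..<x}. ennreal (partial1 C s y) \<partial>lborel)
       = (\<integral>\<^sup>+s\<in>{0..max 0 x}. ennreal (partial1 C s y) \<partial>lborel)"
    proof (rule nn_integral_cong_AE)
      show "AE s in lborel. ennreal (partial1 C s y) * indicator {..<x} s =
         ennreal (partial1 C s y) * indicator {0..max 0 x} s"
        using AE_lborel_singleton[of 0] AE_lborel_singleton[of x]
        by eventually_elim (auto simp: indicator_def partial1_left_of_square)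
    qed
    also have "\<dots> = ennreal (C (max 0 x) y)"
      by (simp add: nn_integral_partial1 zero_left)
    also have "C (max 0 x) y = C x y"
      by (cases "x \<le> 0") (auto simp: zero_left max_def)
    finally show "emeasure (distr ?D borel X) {..<x} = emeasure ?N {..<x}"
      by (simp add: N D')
  qed auto
  then show ?thesis
    using D[OF A] N[OF A] by simp
qed

lemma AE_partial1_above_square: "AE x in lborel. partial1 C x 2 = indicator {0..1} x"
proof -
  have "partial1 C x 2 = indicator {0..1} x" if ne: "x \<noteq> 0" "x \<noteq> 1" for x
  proof -
    have "((\<lambda>s. C s 2) has_real_derivative indicator {0..1} x) (at x)"
    proof -
      consider "x < 0" | "0 < x" "x < 1" | "1 < x" using ne by linarith
      then show ?thesis
      proof cases
        case 1
        show ?thesis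
          by (rule has_field_derivative_transform_within_open[of "\<lambda>_. 0" _ x "{..<0}"])
            (use 1 in \<open>auto simp: zero_left\<close>)
      next
        case 2
        show ?thesis
          by (rule has_field_derivative_transform_within_open[of "\<lambda>s. s" _ x "{0<..<1}"])
            (use 2 in \<open>auto simp: one_right clamp01_def intro!: derivative_eq_intros\<close>)
      next
        case 3
        show ?thesis
          by (rule has_field_derivative_transform_within_open[of "\<lambda>_. 1" _ x "{1<..}"])
            (use 3 in \<open>auto simp: one_left clamp01_def\<close>)
      qed
    qed
    then show ?thesis
      unfolding partial1_def by (rule DERIV_imp_deriv)
  qed
  note off_endpoints = this
  show ?thesis
    using AE_lborel_singleton[of "0::real"] AE_lborel_singleton[of "1::real"]
  proof eventually_elim
    case (elim x)
    then show ?case by (rule off_endpoints)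
  qed
qed

text \<open>
  The law of \<open>X\<close> is obtained from the joint law with \<open>y = 2\<close>, because \<open>Y < 2\<close> holds almost surely.
\<close>

lemma emeasure_left:
  assumes [measurable]: "A \<in> sets borel"
  shows "emeasure M {\<omega> \<in> space M. X \<omega> \<in> A} = emeasure lborel ({0..1} \<inter> A)"
proof -
  have "emeasure M {\<omega> \<in> space M. X \<omega> \<in> A} = emeasure M {\<omega> \<in> space M. X \<omega> \<in> A \<and> Y \<omega> < 2}"
  proof (rule emeasure_eq_AE)
    show "AE \<omega> in M. \<omega> \<in> {\<omega> \<in> space M. X \<omega> \<in> A} \<longleftrightarrow> \<omega> \<in> {\<omega> \<in> space M. X \<omega> \<in> A \<and> Y \<omega> < 2}"
      using AE_right_bound by eventually_elim auto
  qed measurable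
  also have "\<dots> = (\<integral>\<^sup>+x\<in>A. ennreal (partial1 C x 2) \<partial>lborel)"
    by (rule emeasure_joint) fact
  also have "\<dots> = (\<integral>\<^sup>+x. indicator ({0..1} \<inter> A) x \<partial>lborel)"
  proof (rule nn_integral_cong_AE)
    show "AE x in lborel. ennreal (partial1 C x 2) * indicator A x = indicator ({0..1} \<inter> A) x"
      using AE_partial1_above_square by eventually_elim (auto simp: indicator_def)
  qed
  finally show ?thesis by simp
qed

text \<open>
  If \<open>X \<in> E\<close> is almost surely the event \<open>Y < y\<close>, then the law of \<open>X\<close> on \<open>Y < y\<close> is Lebesgue measure on
  \<open>E\<close>, so that its density \<open>\<partial>\<^sub>1C(\<cdot>, y)\<close> is the indicator of \<open>E\<close>. Conversely, if the density takes
  only the values \<open>0\<close> and \<open>1\<close>, then the set where it equals \<open>1\<close> serves as \<open>E\<close>: on this set the law of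
  \<open>X\<close> on \<open>Y < y\<close> has the full mass of \<open>X\<close>, and off it the mass is zero.
\<close>

lemma below_in_left_sets_iff:
  assumes "y \<in> {0..1}"
  shows "(AE x in lborel. x \<in> {0..1} \<longrightarrow> partial1 C x y \<in> {0, 1}) \<longleftrightarrow>
    (\<exists>E\<in>sets borel. AE \<omega> in M. Y \<omega> < y \<longleftrightarrow> X \<omega> \<in> E)"
proof
  assume 01: "AE x in lborel. x \<in> {0..1} \<longrightarrow> partial1 C x y \<in> {0, 1}"
  let ?p = "\<lambda>x. partial1 C x y"
  define E where "E = {x \<in> {0..1}. ?p x = 1}"
  have "{x \<in> space borel. x \<in> {0..1} \<and> ?p x = 1} \<in> sets borel" by measurable
  then have E[measurable]: "E \<in> sets borel" by (simp add: E_def)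
  have in_E: "emeasure M {\<omega> \<in> space M. X \<omega> \<in> E} = emeasure M {\<omega> \<in> space M. X \<omega> \<in> E \<and> Y \<omega> < y}"
  proof -
    have "emeasure M {\<omega> \<in> space M. X \<omega> \<in> E} = emeasure lborel E"
      by (subst emeasure_left) (auto simp: E_def intro!: arg_cong[where f = "emeasure lborel"])
    also have "\<dots> = (\<integral>\<^sup>+x\<in>E. ennreal (?p x) \<partial>lborel)"
    proof -
      have "(\<integral>\<^sup>+x\<in>E. ennreal (?p x) \<partial>lborel) = (\<integral>\<^sup>+x. indicator E x \<partial>lborel)"
        by (intro nn_integral_cong) (auto simp: E_def indicator_def)
      then show ?thesis by simp
    qed
    finally show ?thesis by (simp add: emeasure_joint)
  qed
  have "AE \<omega> in M. X \<omega> \<in> E \<longrightarrow> Y \<omega> < y"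
  proof -
    have "prob {\<omega> \<in> space M. X \<omega> \<in> E \<and> \<not> Y \<omega> < y} =
       prob ({\<omega> \<in> space M. X \<omega> \<in> E} - {\<omega> \<in> space M. X \<omega> \<in> E \<and> Y \<omega> < y})"
      by (intro arg_cong[where f = prob]) auto
    also have "\<dots> = 0"
      using in_E by (subst finite_measure_Diff) (auto simp: measure_def)
    finally have "prob {\<omega> \<in> space M. X \<omega> \<in> E \<and> \<not> Y \<omega> < y} = 0" .
    moreover have ev: "{\<omega> \<in> space M. X \<omega> \<in> E \<and> \<not> Y \<omega> < y} \<in> events" by measurable
    ultimately have "AE \<omega> in M. \<not> (X \<omega> \<in> E \<and> \<not> Y \<omega> < y)"
      using prob_Collect_eq_0[OF ev] by blast
    then show ?thesis by eventually_elim simp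
  qed
  moreover have "AE \<omega> in M. Y \<omega> < y \<longrightarrow> X \<omega> \<in> E"
  proof -
    have "emeasure M {\<omega> \<in> space M. X \<omega> \<in> {0..1} - E \<and> Y \<omega> < y} = (\<integral>\<^sup>+x. 0 \<partial>(lborel :: real measure))"
    proof (subst emeasure_joint, simp, rule nn_integral_cong_AE)
      show "AE x in lborel. ennreal (?p x) * indicator ({0..1} - E) x = 0"
        using 01 by eventually_elim (auto simp: indicator_def E_def)
    qed
    then have 1: "AE \<omega> in M. \<not> (X \<omega> \<in> {0..1} - E \<and> Y \<omega> < y)"
      by (subst AE_iff_measurable[of "{\<omega> \<in> space M. X \<omega> \<in> {0..1} - E \<and> Y \<omega> < y}"]) auto
    have "emeasure M {\<omega> \<in> space M. X \<omega> \<in> - {0..1}} = 0"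
      by (subst emeasure_left) auto
    then have 2: "AE \<omega> in M. \<not> (X \<omega> \<in> - {0..1})"
      by (subst AE_iff_measurable[of "{\<omega> \<in> space M. X \<omega> \<in> - {0..1}}"]) auto
    from 1 2 show ?thesis by eventually_elim auto
  qed
  ultimately have "AE \<omega> in M. Y \<omega> < y \<longleftrightarrow> X \<omega> \<in> E"
    by eventually_elim blast
  then show "\<exists>E\<in>sets borel. AE \<omega> in M. Y \<omega> < y \<longleftrightarrow> X \<omega> \<in> E"
    using E by blast
next
  assume "\<exists>E\<in>sets borel. AE \<omega> in M. Y \<omega> < y \<longleftrightarrow> X \<omega> \<in> E"
  then obtain E where [measurable]: "E \<in> sets borel" and E: "AE \<omega> in M. Y \<omega> < y \<longleftrightarrow> X \<omega> \<in> E" by blast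
  let ?p = "\<lambda>x. ennreal (partial1 C x y)" and ?q = "\<lambda>x. indicator ({0..1} \<inter> E) x :: ennreal"
  have eq: "density lborel ?p = density lborel ?q"
  proof (rule measure_eqI)
    fix A assume "A \<in> sets (density lborel ?p)"
    then have A[measurable]: "A \<in> sets borel" by simp
    have "emeasure (density lborel ?p) A = emeasure M {\<omega> \<in> space M. X \<omega> \<in> A \<and> Y \<omega> < y}"
      by (simp add: emeasure_density emeasure_joint)
    also have "\<dots> = emeasure M {\<omega> \<in> space M. X \<omega> \<in> A \<inter> E}"
    proof (rule emeasure_eq_AE)
      show "AE \<omega> in M. \<omega> \<in> {\<omega> \<in> space M. X \<omega> \<in> A \<and> Y \<omega> < y} \<longleftrightarrow> \<omega> \<in> {\<omega> \<in> space M. X \<omega> \<in> A \<inter> E}"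
        using E by eventually_elim auto
    qed measurable
    also have "\<dots> = emeasure lborel (({0..1} \<inter> E) \<inter> A)"
      by (subst emeasure_left) (auto intro!: arg_cong[where f = "emeasure lborel"])
    also have "\<dots> = emeasure (density lborel ?q) A"
      by (simp add: emeasure_density indicator_inter_arith[symmetric])
    finally show "emeasure (density lborel ?p) A = emeasure (density lborel ?q) A" .
  qed simp
  have "integral\<^sup>N lborel ?p \<noteq> \<infinity>"
    using emeasure_joint[of UNIV y, symmetric] by (simp add: emeasure_eq_measure)
  with eq have "AE x in lborel. ?p x = ?q x"
    using finite_density_unique[of ?p lborel ?q] by simp
  then show "AE x in lborel. x \<in> {0..1} \<longrightarrow> partial1 C x y \<in> {0, 1}"
    using AE_partial1[of y]
  proof eventually_elim
    case (elim x)
    then show ?case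
      by (cases "x \<in> {0..1} \<inter> E") (auto simp: ennreal_eq_0_iff)
  qed
qed

text \<open>
  By \<open>below_in_left_sets_iff\<close> the right-hand side says that almost every event \<open>Y < y\<close> is decided
  by \<open>X\<close>. Almost every \<open>y\<close> suffices, because \<open>Y < y\<close> is a countable union of such events with smaller
  thresholds.
\<close>

lemma determines_iff:
  "determines M X Y \<longleftrightarrow>
    (AE y in lborel. y \<in> {0..1} \<longrightarrow> (AE x in lborel. x \<in> {0..1} \<longrightarrow> partial1 C x y \<in> {0, 1}))"
proof
  assume "determines M X Y"
  moreover have "{..<y} \<in> sets borel" for y :: real by simp
  ultimately have "\<exists>E\<in>sets borel. AE \<omega> in M. Y \<omega> \<in> {..<y} \<longleftrightarrow> X \<omega> \<in> E" for y
    unfolding determines_def by blast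
  then have "\<exists>E\<in>sets borel. AE \<omega> in M. Y \<omega> < y \<longleftrightarrow> X \<omega> \<in> E" for y
    by (simp only: lessThan_iff)
  then have "y \<in> {0..1} \<longrightarrow> (AE x in lborel. x \<in> {0..1} \<longrightarrow> partial1 C x y \<in> {0, 1})" for y
    using below_in_left_sets_iff by blast
  then show "AE y in lborel. y \<in> {0..1} \<longrightarrow> (AE x in lborel. x \<in> {0..1} \<longrightarrow> partial1 C x y \<in> {0, 1})"
    by (intro always_eventually allI)
next
  let ?good = "\<lambda>y. \<exists>E\<in>sets borel. AE \<omega> in M. Y \<omega> < y \<longleftrightarrow> X \<omega> \<in> E"
  assume "AE y in lborel. y \<in> {0..1} \<longrightarrow> (AE x in lborel. x \<in> {0..1} \<longrightarrow> partial1 C x y \<in> {0, 1})"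
  then have good: "AE y in lborel. y \<in> {0..1} \<longrightarrow> ?good y"
    by eventually_elim (use below_in_left_sets_iff in blast)
  have dense: "\<exists>y. a < y \<and> y < b \<and> ?good y" if ab: "0 \<le> a" "a < b" "b \<le> 1" for a b :: real
  proof (rule ccontr)
    assume none: "\<not> ?thesis"
    from good have "AE y in lborel. y \<notin> {a<..<b}"
    proof eventually_elim
      case (elim y)
      then show ?case using none ab by fastforce
    qed
    then have "emeasure lborel {a<..<b} = 0"
      by (subst (asm) AE_iff_measurable[of "{a<..<b}"]) auto
    then show False using \<open>a < b\<close> by simp
  qed
  show "determines M X Y"
  proof (rule determines_generator)
    fix y :: real
    consider "y \<le> 0" | "0 < y" "y \<le> 1" | "1 < y" by linarith
    then show "?good y"
    proof cases
      case 1
      then have "prob {\<omega> \<in> space M. Y \<omega> < y} = 0" by (simp add: marginal_right clamp01_def)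
      moreover have ev: "{\<omega> \<in> space M. Y \<omega> < y} \<in> events" by measurable
      ultimately have "AE \<omega> in M. \<not> Y \<omega> < y"
        using prob_Collect_eq_0[OF ev] by blast
      then show ?thesis by (intro bexI[of _ "{}"]) auto
    next
      case 2
      have "\<forall>n::nat. \<exists>z. max 0 (y - 1 / Suc n) < z \<and> z < y \<and> ?good z"
        using 2 by (intro allI dense) auto
      from choice[OF this] obtain z where z: "\<And>n::nat. max 0 (y - 1 / Suc n) < z n" "\<And>n. z n < y"
        "\<forall>n. ?good (z n)" by blast
      from z(3) have "\<forall>n. \<exists>E. E \<in> sets borel \<and> (AE \<omega> in M. Y \<omega> < z n \<longleftrightarrow> X \<omega> \<in> E)"
        unfolding Bex_def .
      from choice[OF this] obtain E where E: "\<And>n. E n \<in> sets borel"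
        "\<And>n. AE \<omega> in M. Y \<omega> < z n \<longleftrightarrow> X \<omega> \<in> E n" by blast
      have lim: "w < y \<longleftrightarrow> (\<exists>n. w < z n)" for w
      proof
        assume "w < y"
        then obtain n :: nat where "1 / Suc n < y - w" using nat_approx_posE[of "y - w"] by auto
        with z(1)[of n] show "\<exists>n. w < z n" by (intro exI[of _ n]) linarith
      qed (use z(2) order_less_trans in blast)
      from E(2) have "AE \<omega> in M. \<forall>n. Y \<omega> < z n \<longleftrightarrow> X \<omega> \<in> E n"
        by (simp add: AE_all_countable)
      then have "AE \<omega> in M. Y \<omega> < y \<longleftrightarrow> X \<omega> \<in> (\<Union>n. E n)"
        by eventually_elim (auto simp: lim)
      then show ?thesis using E(1) by (intro bexI[of _ "\<Union>n. E n"]) auto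
    next
      case 3
      then have "prob {\<omega> \<in> space M. Y \<omega> < y} = 1" by (simp add: marginal_right clamp01_def)
      moreover have ev: "{\<omega> \<in> space M. Y \<omega> < y} \<in> events" by measurable
      ultimately have "AE \<omega> in M. Y \<omega> < y"
        using prob_Collect_eq_1[OF ev] by blast
      then show ?thesis by (intro bexI[of _ UNIV]) auto
    qed
  qed
qed

lemma sobolev_norm_eq_1_iff_determines:
  "sobolev_norm C = 1 \<longleftrightarrow> determines M X Y \<and> determines M Y X"
  using coupling.determines_iff[OF swap]
  by (simp only: sobolev_norm_eq_1_iff determines_iff partial2_eq)

end

text \<open>
  In particular, a joint distribution function with uniform marginals is a copula; this is how
  the product of two copulas is seen to be one.
\<close>

lemma (in prob_space) coupling_from_uniform_marginals:
  assumes [measurable]: "X \<in> borel_measurable M" "Y \<in> borel_measurable M"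
    and X: "\<And>x. prob {\<omega> \<in> space M. X \<omega> < x} = clamp01 x"
    and Y: "\<And>y. prob {\<omega> \<in> space M. Y \<omega> < y} = clamp01 y"
    and joint: "\<And>x y. prob {\<omega> \<in> space M. X \<omega> < x \<and> Y \<omega> < y} = C x y"
  shows "coupling M X Y C"
proof -
  have uniform: "AE \<omega> in M. Z \<omega> < clamp01 z \<longleftrightarrow> Z \<omega> < z" "AE \<omega> in M. 0 \<le> Z \<omega> \<and> Z \<omega> < 1"
    if [measurable]: "Z \<in> borel_measurable M" and Z: "\<And>z. prob {\<omega> \<in> space M. Z \<omega> < z} = clamp01 z" for Z z
  proof -
    have ev: "{\<omega> \<in> space M. Z \<omega> < z} \<in> events" for z by measurable
    have "AE \<omega> in M. \<not> Z \<omega> < 0"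
      using prob_Collect_eq_0[OF ev[of 0]] Z[of 0] by (simp add: clamp01_def)
    moreover have "AE \<omega> in M. Z \<omega> < 1"
      using prob_Collect_eq_1[OF ev[of 1]] Z[of 1] by (simp add: clamp01_def)
    ultimately show "AE \<omega> in M. 0 \<le> Z \<omega> \<and> Z \<omega> < 1"
      by eventually_elim simp
    then show "AE \<omega> in M. Z \<omega> < clamp01 z \<longleftrightarrow> Z \<omega> < z"
      by eventually_elim (auto simp: clamp01_def)
  qed
  note Xu = uniform[OF assms(1) X] and Yu = uniform[OF assms(2) Y]
  let ?S = "\<lambda>x y. {\<omega> \<in> space M. X \<omega> < x \<and> Y \<omega> < y}"
  have C_cong: "C x y = C x' y'"
    if "AE \<omega> in M. X \<omega> < x \<and> Y \<omega> < y \<longleftrightarrow> X \<omega> < x' \<and> Y \<omega> < y'" for x y x' y'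
    unfolding joint[symmetric]
  proof (rule finite_measure_eq_AE)
    show "AE \<omega> in M. \<omega> \<in> ?S x y \<longleftrightarrow> \<omega> \<in> ?S x' y'"
      using that by eventually_elim auto
  qed measurable
  have clamp: "C (clamp01 x) (clamp01 y) = C x y" for x y
  proof (rule C_cong)
    show "AE \<omega> in M. X \<omega> < clamp01 x \<and> Y \<omega> < clamp01 y \<longleftrightarrow> X \<omega> < x \<and> Y \<omega> < y"
      using Xu(1)[of x] Yu(1)[of y] by eventually_elim simp
  qed
  have right_0: "C x 0 = 0" for x
  proof -
    have "prob (?S x 0) \<le> prob {\<omega> \<in> space M. Y \<omega> < 0}"
      by (rule finite_measure_mono) auto
    then show ?thesis
      using measure_nonneg[of M "?S x 0"] by (simp add: Y joint clamp01_def)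
  qed
  have left_0: "C 0 y = 0" for y
  proof -
    have "prob (?S 0 y) \<le> prob {\<omega> \<in> space M. X \<omega> < 0}"
      by (rule finite_measure_mono) auto
    then show ?thesis
      using measure_nonneg[of M "?S 0 y"] by (simp add: X joint clamp01_def)
  qed
  have right_1: "C x 1 = clamp01 x" for x
  proof -
    have "prob (?S x 1) = prob {\<omega> \<in> space M. X \<omega> < x}"
    proof (rule finite_measure_eq_AE)
      show "AE \<omega> in M. \<omega> \<in> ?S x 1 \<longleftrightarrow> \<omega> \<in> {\<omega> \<in> space M. X \<omega> < x}"
        using Yu(2) by eventually_elim auto
    qed measurable
    then show ?thesis by (simp add: X joint)
  qed
  have left_1: "C 1 y = clamp01 y" for y
  proof -
    have "prob (?S 1 y) = prob {\<omega> \<in> space M. Y \<omega> < y}"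
    proof (rule finite_measure_eq_AE)
      show "AE \<omega> in M. \<omega> \<in> ?S 1 y \<longleftrightarrow> \<omega> \<in> {\<omega> \<in> space M. Y \<omega> < y}"
        using Xu(2) by eventually_elim auto
    qed measurable
    then show ?thesis by (simp add: Y joint)
  qed
  have two_increasing: "C u v - C u y - C x v + C x y \<ge> 0" if "x \<le> u" "y \<le> v" for x u y v
  proof -
    have diff: "prob (?S z v - ?S z y) = C z v - C z y" for z
      using \<open>y \<le> v\<close> by (subst finite_measure_Diff) (auto simp: joint)
    have "prob (?S x v - ?S x y) \<le> prob (?S u v - ?S u y)"
      using \<open>x \<le> u\<close> by (intro finite_measure_mono) auto
    then show ?thesis by (simp add: diff)
  qed
  have range: "C x y \<in> {0..1}" for x y
    unfolding joint[symmetric] by simp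
  have "extended_copula C"
    by unfold_locales
      (use range right_0 left_0 right_1 left_1 two_increasing clamp in \<open>auto simp: copula_def clamp01_ident\<close>)
  then interpret extended_copula C .
  show ?thesis
    by unfold_locales (auto simp: joint)
qed

section \<open>The product of copulas of norm one\<close>

theorem corollary3p5:
  fixes U V :: "real \<Rightarrow> real \<Rightarrow> real"
  assumes "copula U" and "copula V"
  shows "(sobolev_norm U = 1 \<and> sobolev_norm V = 1 \<longrightarrow> sobolev_norm (copula_prod U V) = 1) \<and>
         (sobolev_norm (copula_prod U V) = 1 \<longrightarrow> (sobolev_norm U = 1 \<longleftrightarrow> sobolev_norm V = 1))"
proof -
  let ?U = "extend U" and ?V = "extend V"
  interpret U: extended_copula ?U by (rule extended_copula_extend) fact
  interpret V: extended_copula ?V by (rule extended_copula_extend) fact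
  obtain M :: "(real \<times> real \<times> real) measure" and X T Y where "prob_space M"
    and [measurable]: "X \<in> borel_measurable M" "T \<in> borel_measurable M" "Y \<in> borel_measurable M"
    and joint: "\<And>x t. measure M {\<omega> \<in> space M. X \<omega> < x \<and> T \<omega> < t} = ?U x t"
      "\<And>t y. measure M {\<omega> \<in> space M. T \<omega> < t \<and> Y \<omega> < y} = ?V t y"
      "\<And>x y. measure M {\<omega> \<in> space M. X \<omega> < x \<and> Y \<omega> < y} = copula_prod ?U ?V x y"
    by (rule copula_prod_coupling[OF U.extended_copula_axioms V.extended_copula_axioms]) (rule that)
  interpret M: prob_space M by fact
  interpret XT: coupling M X T ?U
    by unfold_locales (auto simp: joint)
  interpret TY: coupling M T Y ?V
    by unfold_locales (auto simp: joint)
  interpret XY: coupling M X Y "copula_prod ?U ?V"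
    by (rule M.coupling_from_uniform_marginals)
      (auto simp: joint XT.marginal_left TY.marginal_right)
  have ext: "C x y = extend C x y" if "x \<in> {0..1}" "y \<in> {0..1}" for C x y
    using that by (simp add: extend_def clamp01_ident)
  have norms: "sobolev_norm U = sobolev_norm ?U" "sobolev_norm V = sobolev_norm ?V"
    "sobolev_norm (copula_prod U V) = sobolev_norm (copula_prod ?U ?V)"
    by (intro sobolev_norm_cong_square copula_prod_cong_square ext; assumption)+
  have "sobolev_norm U = 1 \<longleftrightarrow> determines M X T \<and> determines M T X"
    unfolding norms by (rule XT.sobolev_norm_eq_1_iff_determines)
  moreover have "sobolev_norm V = 1 \<longleftrightarrow> determines M T Y \<and> determines M Y T"
    unfolding norms by (rule TY.sobolev_norm_eq_1_iff_determines)
  moreover have "sobolev_norm (copula_prod U V) = 1 \<longleftrightarrow> determines M X Y \<and> determines M Y X"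
    unfolding norms by (rule XY.sobolev_norm_eq_1_iff_determines)
  ultimately show ?thesis
    using determines_trans by blast
qed

end
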